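(* Let $G$ be a finite group, let $H$ be a subgroup of $G$, and let $p$ be the smallest prime in $\pi(H)$. If $G=N_{\mathscr{U}_p}(G,H)$, then $H$ is $p$-solvable.
   Context: All groups are finite. $\pi(H)$ is the set of prime divisors of $|H|$. A group is $p$-solvable if each of its chief factors is a $p$-group or a $p'$-group, and $p$-supersolvable if each of its chief factors is either of order $p$ or a $p'$-group. $\mathscr{U}_p$ is the class of $p$-supersolvable groups. For a group $T$, $T^{\mathscr{U}_p}$ is the intersection of all normal subgroups $N$ of $T$ with $T/N\in\mathscr{U}_p$. For $H\le G$, $N_{\mathscr{U}_p}(G,H)=\bigcap_{T\le H}N_G(T^{\mathscr{U}_p})$, over all subgroups $T$ of $H$. *)

theory Defs
  imports "HOL-Algebra.Algebra"
begin

definition order_primes :: "('a, 'b) monoid_scheme \<Rightarrow> nat set"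
  where "order_primes G = prime_factors (Coset.order G)"

definition is_p_group :: "nat \<Rightarrow> ('a, 'b) monoid_scheme \<Rightarrow> bool"
  where "is_p_group p G \<longleftrightarrow> (\<exists>n. Coset.order G = p ^ n)"

definition is_p'_group :: "nat \<Rightarrow> ('a, 'b) monoid_scheme \<Rightarrow> bool"
  where "is_p'_group p G \<longleftrightarrow> \<not> p dvd Coset.order G"

text \<open>The chief factor \<open>K / L\<close> of \<open>G\<close> is represented by the pair \<open>K\<close>, \<open>L\<close>; as a group
  it is \<open>chief_quotient G K L\<close>.\<close>

abbreviation chief_quotient :: "('a, 'b) monoid_scheme \<Rightarrow> 'a set \<Rightarrow> 'a set \<Rightarrow> 'a set monoid"
  where "chief_quotient G K L \<equiv> (G\<lparr>carrier := K\<rparr>) Mod L"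

definition chief_factor :: "('a, 'b) monoid_scheme \<Rightarrow> 'a set \<Rightarrow> 'a set \<Rightarrow> bool"
  where "chief_factor G K L \<longleftrightarrow>
    K \<lhd> G \<and> L \<lhd> G \<and> L \<subset> K \<and> \<not> (\<exists>M. M \<lhd> G \<and> L \<subset> M \<and> M \<subset> K)"

definition p_solvable :: "nat \<Rightarrow> ('a, 'b) monoid_scheme \<Rightarrow> bool"
  where "p_solvable p G \<longleftrightarrow> group G \<and> finite (carrier G) \<and>
    (\<forall>K L. chief_factor G K L \<longrightarrow>
      is_p_group p (chief_quotient G K L) \<or> is_p'_group p (chief_quotient G K L))"

definition p_supersolvable :: "nat \<Rightarrow> ('a, 'b) monoid_scheme \<Rightarrow> bool"
  where "p_supersolvable p G \<longleftrightarrow> group G \<and> finite (carrier G) \<and>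
    (\<forall>K L. chief_factor G K L \<longrightarrow>
      Coset.order (chief_quotient G K L) = p \<or> is_p'_group p (chief_quotient G K L))"

definition p_supersolvable_residual :: "nat \<Rightarrow> ('a, 'b) monoid_scheme \<Rightarrow> 'a set"
  where "p_supersolvable_residual p T = \<Inter>{N. N \<lhd> T \<and> p_supersolvable p (T Mod N)}"

text \<open>The intersection \<open>N\<^bsub>\<U>\<^sub>p\<^esub>(G, H)\<close> over all subgroups \<open>T\<close> of \<open>H\<close>; the normalizers are taken
  in the whole group \<open>G\<close>.\<close>

definition residual_normalizer ::
    "nat \<Rightarrow> ('a, 'b) monoid_scheme \<Rightarrow> 'a set \<Rightarrow> 'a set"
  where "residual_normalizer p G H =
    (\<Inter>T\<in>{T. subgroup T (G\<lparr>carrier := H\<rparr>)}.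
      normalizer G (p_supersolvable_residual p (G\<lparr>carrier := T\<rparr>)))"

end

theory Submission
  imports Defs
begin

text \<open>
  The claim is local to the chief factors \<open>K / L\<close> of \<open>H\<close> whose order is divisible by \<open>p\<close>:
  every one of them is a \<open>p\<close>-group.

  The hypothesis says that for every \<open>T \<le> H\<close> the residual \<open>U\<close> of \<open>T\<close> is normal in \<open>H\<close>. If
  \<open>L \<le> T < K\<close>, then \<open>U L\<close> is normal in \<open>H\<close> and lies between \<open>L\<close> and \<open>T\<close>, hence \<open>U \<le> L\<close> because
  \<open>K / L\<close> is a chief factor. Since the \<open>p\<close>-supersolvable groups form a formation, \<open>T / U\<close> and
  therefore \<open>T / L\<close> is \<open>p\<close>-supersolvable (\<open>proper_subgroup_chief_quotient_p_supersolvable\<close>). So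
  \<open>S = K / L\<close> is a characteristically simple group, all of whose proper subgroups are
  \<open>p\<close>-supersolvable, and \<open>p\<close> is the least prime divisor of its order.

  Such an \<open>S\<close> is a \<open>p\<close>-group (\<open>p_group_if_proper_subgroups_p_supersolvable\<close>). Suppose that it is
  not. Then it has no nontrivial normal \<open>p\<close>-subgroup, because the intersection of the Sylow
  \<open>p\<close>-subgroups is characteristic. So for every nontrivial \<open>p\<close>-subgroup \<open>D\<close> the normalizer of \<open>D\<close> is
  proper and hence \<open>p\<close>-supersolvable. As \<open>p\<close> is the least prime, the elements of order prime to
  \<open>p\<close> act trivially on the chief factors of order \<open>p\<close> below \<open>D\<close>, and by coprimality on \<open>D\<close> itself;
  thus \<open>N(D) = C(D) Q\<close> for every Sylow \<open>p\<close>-subgroup \<open>Q\<close> of \<open>N(D)\<close>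
  (\<open>p_supersolvable_factorization\<close>). The argument behind Frobenius' criterion for normal
  \<open>p\<close>-complements now shows that a Sylow \<open>p\<close>-subgroup \<open>P\<close> of \<open>S\<close> controls its own fusion
  (\<open>sylow_subgroup_controls_fusion\<close>). The transfer of \<open>S\<close> into a quotient of order \<open>p\<close> of \<open>P\<close>
  then is nontrivial (\<open>exists_normal_if_fusion_controlled\<close>), so its kernel is a proper normal
  subgroup that contains all elements of order prime to \<open>p\<close>. The intersection of the images of
  this kernel under the automorphisms of \<open>S\<close> is trivial and still contains these elements. So
  there are none besides \<open>\<one>\<close>, and \<open>S\<close> is a \<open>p\<close>-group after all.
\<close>

text \<open>From here on \<open>prime\<close> is the predicate on numbers, not the one on elements of a monoid.\<close>

hide_const (open) Divisibility.prime

section \<open>Fixed points of \<open>p\<close>-groups and Sylow subgroups\<close>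

text \<open>A nontrivial orbit has a length that divides \<open>p ^ n\<close> and is not \<open>1\<close>. This is the form of the congruence
between the numbers of points and of fixed points that needs no subtraction of natural numbers.
The action is given by an arbitrary function, because the actions below (on a normal subgroup, on
right cosets) are not extensional.\<close>

lemma p_group_moved_points_dvd:
  fixes G (structure) and act :: "'a \<Rightarrow> 'e \<Rightarrow> 'e"
  assumes "group G" "prime p" "order G = p ^ n" "finite E"
    and closed: "\<And>g e. g \<in> carrier G \<Longrightarrow> e \<in> E \<Longrightarrow> act g e \<in> E"
    and one: "\<And>e. e \<in> E \<Longrightarrow> act \<one> e = e"
    and mult: "\<And>g h e. g \<in> carrier G \<Longrightarrow> h \<in> carrier G \<Longrightarrow> e \<in> E \<Longrightarrow>
      act (g \<otimes> h) e = act g (act h e)"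
  shows "p dvd card {e \<in> E. \<exists>g \<in> carrier G. act g e \<noteq> e}"
proof -
  interpret group G by fact
  define \<phi> where "\<phi> g = restrict (act g) E" for g
  have inv_act: "act (inv g) (act g e) = e" if "g \<in> carrier G" "e \<in> E" for g e
    using that mult[of "inv g" g e] one by simp
  have act_inv: "act g (act (inv g) e) = e" if "g \<in> carrier G" "e \<in> E" for g e
    using that mult[of g "inv g" e] one by simp
  have bij: "\<phi> g \<in> Bij E" if g: "g \<in> carrier G" for g
  proof -
    have "bij_betw (act g) E E"
      by (rule bij_betw_byWitness[where f' = "act (inv g)"])
        (use g inv_act act_inv closed in auto)
    then show ?thesis
      by (simp add: Bij_def \<phi>_def bij_betw_restrict_eq)
  qed
  interpret act: group_action G E \<phi>
    unfolding group_action_def group_hom_def group_hom_axioms_def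
  proof (intro conjI)
    show "\<phi> \<in> hom G (BijGroup E)"
    proof (rule homI)
      fix g h assume g: "g \<in> carrier G" and h: "h \<in> carrier G"
      show "\<phi> (g \<otimes> h) = \<phi> g \<otimes>\<^bsub>BijGroup E\<^esub> \<phi> h"
        using bij[OF g] bij[OF h] mult[OF g h] closed[OF h]
        by (auto simp: BijGroup_def \<phi>_def compose_def fun_eq_iff restrict_def)
    qed (simp add: BijGroup_def bij)
  qed (simp_all add: group_BijGroup is_group)
  define M where "M = {e \<in> E. \<exists>g \<in> carrier G. act g e \<noteq> e}"
  have "p dvd (\<Sum>e\<in>orb. if e \<in> M then 1 else (0::nat))" if in_orbits: "orb \<in> orbits G E \<phi>" for orb
  proof -
    obtain x where x: "x \<in> E" and orb: "orb = orbit G \<phi> x"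
      using in_orbits unfolding orbits_def by blast
    have orb_act: "orb = (\<lambda>g. act g x) ` carrier G"
      using x by (auto simp: orb orbit_def \<phi>_def)
    show ?thesis
    proof (cases "x \<in> M")
      case False
      then have "orb = {x}"
        using x one by (force simp: orb_act M_def)
      then show ?thesis using False by simp
    next
      case True
      have "e \<in> M" if in_orb: "e \<in> orb" for e
      proof (rule ccontr)
        assume "e \<notin> M"
        obtain g where g: "g \<in> carrier G" "e = act g x" using in_orb by (auto simp: orb_act)
        then have e: "e \<in> E" using closed x by simp
        then have fixed: "\<And>h. h \<in> carrier G \<Longrightarrow> act h e = e"
          using \<open>e \<notin> M\<close> by (auto simp: M_def)
        then have "x = e" using g x inv_act[of g x] by auto
        then show False using True \<open>e \<notin> M\<close> by simp
      qed
      then have "(\<Sum>e\<in>orb. if e \<in> M then 1 else (0::nat)) = card orb" by simp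
      moreover have "p dvd card orb"
      proof -
        have "card orb dvd p ^ n"
          using act.orbit_stabilizer_theorem[OF x] orb \<open>order G = p ^ n\<close>
          by (metis dvd_triv_left)
        then obtain k where k: "card orb = p ^ k"
          using \<open>prime p\<close> by (auto simp: divides_primepow_nat)
        obtain g where "g \<in> carrier G" "act g x \<noteq> x" using True by (auto simp: M_def)
        moreover have "x \<in> orb" using one x unfolding orb_act by (metis one_closed image_eqI)
        ultimately have "card orb \<noteq> 1"
          unfolding orb_act by (metis (no_types, lifting) \<open>x \<in> orb\<close> card_1_singletonE image_eqI orb_act singletonD)
        then show ?thesis using k by (cases k) auto
      qed
      ultimately show ?thesis by simp
    qed
  qed
  then have "p dvd (\<Sum>orb\<in>orbits G E \<phi>. \<Sum>e\<in>orb. if e \<in> M then 1 else (0::nat))"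
    by (rule dvd_sum)
  also have "\<dots> = (\<Sum>e\<in>E. if e \<in> M then 1 else (0::nat))"
    using act.disjoint_sum[OF \<open>finite E\<close>] .
  also have "\<dots> = card M"
    using \<open>finite E\<close> by (simp add: M_def sum.If_cases Int_def)
  finally show ?thesis by (simp add: M_def)
qed

definition conjugate_set :: "('a, 'b) monoid_scheme \<Rightarrow> 'a \<Rightarrow> 'a set \<Rightarrow> 'a set"
  where "conjugate_set G g A = (\<lambda>x. g \<otimes>\<^bsub>G\<^esub> x \<otimes>\<^bsub>G\<^esub> inv\<^bsub>G\<^esub> g) ` A"

definition centralizer :: "('a, 'b) monoid_scheme \<Rightarrow> 'a set \<Rightarrow> 'a set"
  where "centralizer G A = {c \<in> carrier G. \<forall>x \<in> A. c \<otimes>\<^bsub>G\<^esub> x = x \<otimes>\<^bsub>G\<^esub> c}"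

text \<open>The index, not the exponent of \<open>p\<close>, is used: it passes directly to subgroups between \<open>P\<close> and \<open>G\<close>.\<close>

definition sylow_subgroup :: "nat \<Rightarrow> ('a, 'b) monoid_scheme \<Rightarrow> 'a set \<Rightarrow> bool"
  where "sylow_subgroup p G P \<longleftrightarrow> subgroup P G \<and> (\<exists>a. card P = p ^ a) \<and> \<not> p dvd card (rcosets\<^bsub>G\<^esub> P)"

context group
begin


lemma conjugate_set_mult:
  assumes "g \<in> carrier G" "h \<in> carrier G" "A \<subseteq> carrier G"
  shows "conjugate_set G g (conjugate_set G h A) = conjugate_set G (g \<otimes> h) A"
proof -
  have "g \<otimes> (h \<otimes> x \<otimes> inv h) \<otimes> inv g = (g \<otimes> h) \<otimes> x \<otimes> inv (g \<otimes> h)" if "x \<in> A" for x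
    using assms that by (simp add: inv_mult_group m_assoc subsetD[OF assms(3)])
  then show ?thesis by (simp add: conjugate_set_def image_image cong: image_cong)
qed

lemma conjugate_set_one: "A \<subseteq> carrier G \<Longrightarrow> conjugate_set G \<one> A = A"
  by (auto simp: conjugate_set_def subset_iff image_def)

lemma conjugate_set_closed:
  "g \<in> carrier G \<Longrightarrow> A \<subseteq> carrier G \<Longrightarrow> conjugate_set G g A \<subseteq> carrier G"
  by (auto simp: conjugate_set_def)

lemma conjugate_set_mono: "A \<subseteq> B \<Longrightarrow> conjugate_set G g A \<subseteq> conjugate_set G g B"
  by (auto simp: conjugate_set_def)

lemma conjugate_set_inv:
  assumes "g \<in> carrier G" "A \<subseteq> carrier G"
  shows "conjugate_set G (inv g) (conjugate_set G g A) = A"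
    and "conjugate_set G g (conjugate_set G (inv g) A) = A"
  using assms by (simp_all add: conjugate_set_mult conjugate_set_one)

lemma conj_hom:
  assumes "g \<in> carrier G"
  shows "(\<lambda>x. g \<otimes> x \<otimes> inv g) \<in> hom G G"
proof (rule homI)
  fix x y assume "x \<in> carrier G" "y \<in> carrier G"
  then show "g \<otimes> (x \<otimes> y) \<otimes> inv g = g \<otimes> x \<otimes> inv g \<otimes> (g \<otimes> y \<otimes> inv g)"
    using assms by (simp add: m_assoc) (simp add: m_assoc[symmetric])
qed (simp add: assms)

lemma subgroup_conjugate_set:
  assumes "g \<in> carrier G" "subgroup A G"
  shows "subgroup (conjugate_set G g A) G"
proof -
  interpret group_hom G G "\<lambda>x. g \<otimes> x \<otimes> inv g"
    by unfold_locales (rule conj_hom[OF assms(1)])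
  show ?thesis using subgroup_img_is_subgroup[OF assms(2)] by (simp add: conjugate_set_def)
qed

lemma card_conjugate_set:
  assumes "g \<in> carrier G" "A \<subseteq> carrier G"
  shows "card (conjugate_set G g A) = card A"
  unfolding conjugate_set_def
proof (rule card_image, rule inj_onI)
  fix x y assume "x \<in> A" "y \<in> A" "g \<otimes> x \<otimes> inv g = g \<otimes> y \<otimes> inv g"
  then show "x = y" using assms(1) subsetD[OF assms(2)] by simp
qed

lemma mem_normalizer_iff:
  assumes "D \<subseteq> carrier G"
  shows "g \<in> normalizer G D \<longleftrightarrow> g \<in> carrier G \<and> conjugate_set G g D = D"
proof -
  have "g <# D #> inv g = conjugate_set G g D"
    by (auto simp: conjugate_set_def l_coset_def r_coset_def)
  then show ?thesis using assms by (auto simp: normalizer_def stabilizer_def)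
qed

text \<open>For a finite set one inclusion is enough, by counting.\<close>

lemma mem_normalizerI:
  assumes "finite D" "D \<subseteq> carrier G" "g \<in> carrier G" "\<And>d. d \<in> D \<Longrightarrow> g \<otimes> d \<otimes> inv g \<in> D"
  shows "g \<in> normalizer G D"
proof -
  have "conjugate_set G g D \<subseteq> D" using assms by (auto simp: conjugate_set_def)
  then have "conjugate_set G g D = D"
    using assms by (intro card_subset_eq) (auto simp: card_conjugate_set)
  then show ?thesis using assms by (simp add: mem_normalizer_iff)
qed

lemma normal_iff_normalizer:
  assumes "subgroup D G"
  shows "D \<lhd> G \<longleftrightarrow> normalizer G D = carrier G"
proof
  assume D: "D \<lhd> G"
  have "conjugate_set G g D = D" if "g \<in> carrier G" for g
  proof -
    have "conjugate_set G g D \<subseteq> D" "conjugate_set G (inv g) D \<subseteq> D"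
      using that normal.inv_op_closed2[OF D] normal.inv_op_closed1[OF D]
      by (auto simp: conjugate_set_def)
    then show ?thesis
      using conjugate_set_mono[of "conjugate_set G (inv g) D" D g] that
        conjugate_set_inv(2)[OF that subgroup.subset[OF assms]] by auto
  qed
  then show "normalizer G D = carrier G"
    using mem_normalizer_iff[OF subgroup.subset[OF assms]] by auto
next
  assume eq: "normalizer G D = carrier G"
  show "D \<lhd> G"
    by (rule normal_invI[OF assms])
      (use eq mem_normalizer_iff[OF subgroup.subset[OF assms]] in \<open>auto simp: conjugate_set_def\<close>)
qed

lemma subgroup_centralizer:
  assumes "A \<subseteq> carrier G"
  shows "subgroup (centralizer G A) G"
proof (rule subgroupI)
  fix a b assume a: "a \<in> centralizer G A" and b: "b \<in> centralizer G A"
  have "a \<otimes> b \<otimes> x = x \<otimes> (a \<otimes> b)" if "x \<in> A" for x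
    using that a b assms unfolding centralizer_def
    by (smt (verit, best) m_assoc mem_Collect_eq subsetD)
  then show "a \<otimes> b \<in> centralizer G A" using a b by (simp add: centralizer_def)
  have "inv a \<otimes> x = x \<otimes> inv a" if "x \<in> A" for x
  proof -
    have *: "a \<in> carrier G" "x \<in> carrier G" "a \<otimes> x = x \<otimes> a"
      using that a assms by (auto simp: centralizer_def)
    then have "x = a \<otimes> (x \<otimes> inv a)" by (simp add: m_assoc[symmetric]) (simp add: m_assoc)
    then show ?thesis using * inv_solve_left[of "x \<otimes> inv a" a x] by simp
  qed
  then show "inv a \<in> centralizer G A" using a by (simp add: centralizer_def)
qed (use assms in \<open>auto simp: centralizer_def subset_iff\<close>)

lemma centralizer_conj:
  assumes "c \<in> centralizer G A" "x \<in> A" "A \<subseteq> carrier G"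
  shows "c \<otimes> x \<otimes> inv c = x"
  using assms by (auto simp: centralizer_def m_assoc subset_iff)

lemma centralizer_antimono: "A \<subseteq> B \<Longrightarrow> centralizer G B \<subseteq> centralizer G A"
  by (auto simp: centralizer_def)

lemma card_subgroup_dvd:
  assumes "subgroup A G" "subgroup B G" "A \<subseteq> B"
  shows "card A dvd card B"
proof -
  interpret B: group "G\<lparr>carrier := B\<rparr>" using assms subgroup_imp_group by blast
  have "subgroup A (G\<lparr>carrier := B\<rparr>)" using assms subgroup_incl by blast
  then have "card (rcosets\<^bsub>G\<lparr>carrier := B\<rparr>\<^esub> A) * card A = card B" using B.lagrange[of A] by (simp add: order_def)
  then show ?thesis by (metis dvd_triv_right)
qed

lemma card_normal_set_mult:
  assumes "N \<lhd> G" "subgroup S G"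
  shows "card (N <#> S) * card (N \<inter> S) = card N * card S"
proof -
  interpret second_isomorphism_grp N G S
    using assms by (simp add: second_isomorphism_grp_def second_isomorphism_grp_axioms_def)
  note NS = normal_set_mult_subgroup
  interpret NS: group "G\<lparr>carrier := N <#> S\<rparr>" using NS subgroup_imp_group by blast
  interpret S: group "G\<lparr>carrier := S\<rparr>" using assms(2) subgroup_imp_group by blast
  have "card (carrier ((G\<lparr>carrier := N <#> S\<rparr>) Mod N)) = card (carrier (G\<lparr>carrier := S\<rparr> Mod (N \<inter> S)))"
    using iso_same_card[OF is_isoI[OF normal_intersection_quotient_isom]] by simp
  moreover have "subgroup N (G\<lparr>carrier := N <#> S\<rparr>)"
    using H_contained_in_set_mult NS is_subgroup subgroup_incl by blast
  moreover have "subgroup (N \<inter> S) (G\<lparr>carrier := S\<rparr>)"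
    using subgroup_incl assms(2) is_subgroup subgroups_Inter_pair by blast
  moreover define k where "k = card (rcosets\<^bsub>G\<lparr>carrier := S\<rparr>\<^esub> (N \<inter> S))"
  ultimately have "k * card N = card (N <#> S)" "k * card (N \<inter> S) = card S"
    using NS.lagrange[of N] S.lagrange[of "N \<inter> S"] by (simp_all add: FactGroup_def order_def)
  then show ?thesis by (simp flip: \<open>k * card N = card (N <#> S)\<close> \<open>k * card (N \<inter> S) = card S\<close>)
qed

lemma rcoset_conj_mem:
  assumes "subgroup Q G" "g \<in> carrier G" "d \<in> carrier G" "(Q #> g) #> d = Q #> g"
  shows "g \<otimes> d \<otimes> inv g \<in> Q"
proof -
  have "Q #> (g \<otimes> d) = Q #> g"
    using assms by (simp add: coset_mult_assoc subgroup.subset)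
  then have "g \<otimes> d \<in> Q #> g" using rcos_self[of "g \<otimes> d" Q] assms by simp
  then show ?thesis using subgroup.rcos_module_imp[OF assms(1) is_group assms(2)] by simp
qed

lemma finite_rcosets: "finite (carrier G) \<Longrightarrow> finite (rcosets Q)"
  by (simp add: RCOSETS_def)

lemma rcosets_closed:
  "subgroup Q G \<Longrightarrow> C \<in> rcosets Q \<Longrightarrow> g \<in> carrier G \<Longrightarrow> C #> g \<in> rcosets Q"
  by (auto simp: RCOSETS_def coset_mult_assoc subgroup.subset)

text \<open>\<open>D\<close> acts on the right cosets of \<open>Q\<close>, with \<open>d\<close> acting as multiplication by \<open>inv d\<close> to make it a
left action. A coset \<open>Q #> g\<close> that is fixed by \<open>D\<close> means \<open>conjugate_set G g D \<subseteq> Q\<close> (\<open>rcoset_conj_mem\<close>),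
so the count of the fixed cosets yields both Sylow's conjugacy theorem (index of \<open>Q\<close> prime to \<open>p\<close>) and the
growth of normalizers in \<open>p\<close>-groups (\<open>Q = D\<close>).\<close>

lemma p_subgroup_moved_rcosets_dvd:
  assumes "finite (carrier G)" "prime p" "subgroup D G" "card D = p ^ n" "subgroup Q G"
  shows "p dvd card {C \<in> rcosets Q. \<exists>d \<in> D. C #> d \<noteq> C}"
proof -
  have "p dvd card {C \<in> rcosets Q. \<exists>d \<in> carrier (G\<lparr>carrier := D\<rparr>). C #> inv d \<noteq> C}"
  proof (rule p_group_moved_points_dvd[OF subgroup_imp_group[OF assms(3)] assms(2)])
    show "finite (rcosets Q)" using assms finite_rcosets by simp
    show "order (G\<lparr>carrier := D\<rparr>) = p ^ n" using assms by (simp add: order_def)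
    fix C assume C: "C \<in> rcosets Q"
    then have CG: "C \<subseteq> carrier G" using subgroup.rcosets_carrier[OF assms(5) is_group] by simp
    then show "C #> inv \<one>\<^bsub>G\<lparr>carrier := D\<rparr>\<^esub> = C" by simp
    fix g assume g: "g \<in> carrier (G\<lparr>carrier := D\<rparr>)"
    then have gG: "g \<in> carrier G" using subgroup.mem_carrier[OF assms(3)] by simp
    then show "C #> inv g \<in> rcosets Q" using C assms rcosets_closed by simp
    fix h assume h: "h \<in> carrier (G\<lparr>carrier := D\<rparr>)"
    then have "h \<in> carrier G" using subgroup.mem_carrier[OF assms(3)] by simp
    then show "C #> inv (g \<otimes>\<^bsub>G\<lparr>carrier := D\<rparr>\<^esub> h) = C #> inv h #> inv g"
      using gG CG by (simp add: inv_mult_group coset_mult_assoc)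
  qed
  also have "{C \<in> rcosets Q. \<exists>d \<in> carrier (G\<lparr>carrier := D\<rparr>). C #> inv d \<noteq> C}
      = {C \<in> rcosets Q. \<exists>d \<in> D. C #> d \<noteq> C}"
  proof -
    have "(\<lambda>d. inv d) ` D = D"
      using subgroup.m_inv_closed[OF assms(3)] subgroup.mem_carrier[OF assms(3)]
      by (force simp: image_iff intro: bexI[of _ "inv _"])
    then have "(\<exists>d \<in> D. C #> inv d \<noteq> C) \<longleftrightarrow> (\<exists>d \<in> D. C #> d \<noteq> C)" for C
      by (metis (no_types, lifting) image_iff)
    then show ?thesis by simp
  qed
  finally show ?thesis .
qed

lemma p_subgroup_conj_into:
  assumes "finite (carrier G)" "prime p" "subgroup D G" "card D = p ^ n"
    and "subgroup Q G" "\<not> p dvd card (rcosets Q)"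
  obtains g where "g \<in> carrier G" "conjugate_set G g D \<subseteq> Q"
proof -
  have "{C \<in> rcosets Q. \<exists>d \<in> D. C #> d \<noteq> C} \<noteq> rcosets Q"
    using p_subgroup_moved_rcosets_dvd[OF assms(1-5)] assms(6) by auto
  then obtain C where C: "C \<in> rcosets Q" "\<And>d. d \<in> D \<Longrightarrow> C #> d = C" by blast
  then obtain g where g: "g \<in> carrier G" "C = Q #> g" by (auto simp: RCOSETS_def)
  have "conjugate_set G g D \<subseteq> Q"
    using rcoset_conj_mem[OF assms(5) g(1)] C g subgroup.mem_carrier[OF assms(3)]
    by (auto simp: conjugate_set_def)
  then show thesis using that g by blast
qed

lemma sylow_subgroupD:
  assumes "sylow_subgroup p G P"
  shows "order G = card P * card (rcosets P)" "subgroup P G" "\<not> p dvd card (rcosets P)"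
    "\<exists>a. card P = p ^ a"
  using assms lagrange[of P] by (auto simp: sylow_subgroup_def mult.commute)

lemma sylow_subgroup_card:
  assumes "finite (carrier G)" "prime p" "sylow_subgroup p G P"
  shows "card P = p ^ multiplicity p (order G)"
proof -
  obtain a where a: "card P = p ^ a" using assms sylow_subgroupD by blast
  have pos: "order G \<noteq> 0" using assms(1) order_gt_0_iff_finite by simp
  have "multiplicity p (order G) = multiplicity p (card P) + multiplicity p (card (rcosets P))"
    using sylow_subgroupD(1)[OF assms(3)] assms(2) pos
    by (metis mult_eq_0_iff prime_elem_multiplicity_mult_distrib prime_imp_prime_elem)
  also have "\<dots> = a"
    using a sylow_subgroupD(3)[OF assms(3)] \<open>prime p\<close>
    by (simp add: not_dvd_imp_multiplicity_0 prime_nat_iff multiplicity_prime_power)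
  finally show ?thesis using a by simp
qed

lemma sylow_subgroupI:
  assumes "finite (carrier G)" "prime p" "subgroup P G" "card P = p ^ multiplicity p (order G)"
  shows "sylow_subgroup p G P"
proof -
  have pos: "order G \<noteq> 0" using assms(1) order_gt_0_iff_finite by simp
  have "\<not> p dvd card (rcosets P)"
  proof
    assume "p dvd card (rcosets P)"
    then have "p ^ Suc (multiplicity p (order G)) dvd order G"
      using lagrange[OF assms(3)] assms(4) by (metis mult_dvd_mono dvd_refl power_Suc)
    then show False
      using pos prime_gt_1_nat[OF assms(2)] multiplicity_geI[of "order G" p "Suc (multiplicity p (order G))"]
      by auto
  qed
  then show ?thesis using assms by (auto simp: sylow_subgroup_def)
qed

lemma sylow_subgroup_exists:
  assumes "finite (carrier G)" "prime p"
  obtains P where "sylow_subgroup p G P"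
proof -
  have "p ^ multiplicity p (order G) dvd order G" by (rule multiplicity_dvd)
  then obtain m where "order G = p ^ multiplicity p (order G) * m" by (auto elim: dvdE)
  then obtain P where "subgroup P G" "card P = p ^ multiplicity p (order G)"
    using sylow_thm[OF assms(2) is_group] assms(1) by blast
  then show thesis using that sylow_subgroupI assms by blast
qed

lemma sylow_subgroup_conjugate_set:
  assumes "finite (carrier G)" "prime p" "sylow_subgroup p G P" "g \<in> carrier G"
  shows "sylow_subgroup p G (conjugate_set G g P)"
  using sylow_subgroupD(2)[OF assms(3)] sylow_subgroup_card[OF assms(1-3)] assms
  by (intro sylow_subgroupI) (simp_all add: card_conjugate_set subgroup.subset subgroup_conjugate_set)

lemma sylow_subgroups_conjugate:
  assumes "finite (carrier G)" "prime p" "sylow_subgroup p G P" "sylow_subgroup p G Q"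
  obtains g where "g \<in> carrier G" "conjugate_set G g P = Q"
proof -
  obtain g where g: "g \<in> carrier G" "conjugate_set G g P \<subseteq> Q"
    using p_subgroup_conj_into[of p P _ Q] assms sylow_subgroupD[OF assms(3)]
      sylow_subgroupD[OF assms(4)] by metis
  have "finite Q" using assms sylow_subgroupD(2) subgroup.subset finite_subset by metis
  then have "conjugate_set G g P = Q"
    using g sylow_subgroup_card[OF assms(1,2)] assms(3,4)
      subgroup.subset[OF sylow_subgroupD(2)[OF assms(3)]]
    by (intro card_subset_eq) (simp_all add: card_conjugate_set)
  then show thesis using that g by blast
qed

lemma p_subgroup_le_sylow_subgroup:
  assumes "finite (carrier G)" "prime p" "subgroup D G" "card D = p ^ n"
  obtains P where "sylow_subgroup p G P" "D \<subseteq> P"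
proof -
  obtain Q where Q: "sylow_subgroup p G Q" using sylow_subgroup_exists assms by blast
  then obtain g where g: "g \<in> carrier G" "conjugate_set G g D \<subseteq> Q"
    using p_subgroup_conj_into[OF assms] sylow_subgroupD by metis
  then have "conjugate_set G (inv g) (conjugate_set G g D) \<subseteq> conjugate_set G (inv g) Q"
    using conjugate_set_mono by blast
  then have "D \<subseteq> conjugate_set G (inv g) Q"
    using conjugate_set_inv g assms subgroup.subset by metis
  then show thesis using that sylow_subgroup_conjugate_set[OF assms(1,2) Q] g by blast
qed

text \<open>\<open>D\<close> permutes its own cosets in \<open>P\<close>. Their number is divisible by \<open>p\<close> and \<open>D\<close> is one fixed coset,
so there is a second one \<open>D #> g\<close>.\<close>

lemma p_group_normalizer_grows:
  assumes "finite (carrier G)" "prime p" "subgroup P G" "card P = p ^ n" "subgroup D G" "D \<subset> P"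
  obtains g where "g \<in> P" "g \<notin> D" "g \<in> normalizer G D"
proof -
  interpret P: group "G\<lparr>carrier := P\<rparr>" using assms subgroup_imp_group by blast
  let ?P = "G\<lparr>carrier := P\<rparr>"
  have finP: "finite P" using assms subgroup.subset finite_subset by metis
  have D: "subgroup D ?P" using assms subgroup_incl by blast
  have "card D dvd p ^ n" using assms card_subgroup_dvd by (metis psubset_imp_subset)
  then obtain k where k: "card D = p ^ k" using \<open>prime p\<close> by (auto simp: divides_primepow_nat)
  have eq: "card (rcosets\<^bsub>?P\<^esub> D) * p ^ k = p ^ n"
    using P.lagrange[OF D] assms k by (simp add: order_def)
  have "card D < card P" using psubset_card_mono[OF finP] assms(6) by simp
  have dvd: "p dvd card (rcosets\<^bsub>?P\<^esub> D)"
  proof -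
    have "card (rcosets\<^bsub>?P\<^esub> D) dvd p ^ n" using eq by (metis dvd_triv_left)
    then obtain j where j: "card (rcosets\<^bsub>?P\<^esub> D) = p ^ j"
      using \<open>prime p\<close> by (auto simp: divides_primepow_nat)
    then show ?thesis using eq k \<open>card D < card P\<close> assms by (cases j) auto
  qed
  define F where "F = {C \<in> rcosets\<^bsub>?P\<^esub> D. \<forall>d \<in> D. C #>\<^bsub>?P\<^esub> d = C}"
  have fin: "finite (rcosets\<^bsub>?P\<^esub> D)" using finP P.finite_rcosets by simp
  define M where "M = {C \<in> rcosets\<^bsub>?P\<^esub> D. \<exists>d \<in> D. C #>\<^bsub>?P\<^esub> d \<noteq> C}"
  have "rcosets\<^bsub>?P\<^esub> D = F \<union> M" "F \<inter> M = {}"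
    by (auto simp: F_def M_def)
  then have "card (rcosets\<^bsub>?P\<^esub> D) = card F + card M"
    using fin card_Un_disjoint[of F M] by simp
  moreover have "p dvd card M"
    using P.p_subgroup_moved_rcosets_dvd[OF _ \<open>prime p\<close> D k D] finP by (simp add: M_def)
  ultimately have "p dvd card F" using dvd by (simp add: dvd_add_left_iff)
  moreover have DF: "D \<in> F"
    using subgroup.subgroup_in_rcosets[OF D P.is_group] subgroup.rcos_const[OF D P.is_group]
    by (simp add: F_def)
  ultimately have "F \<noteq> {D}" using \<open>prime p\<close> by auto
  then obtain C where C: "C \<in> F" "C \<noteq> D" using DF by auto
  then obtain g where g: "g \<in> P" "C = D #>\<^bsub>?P\<^esub> g" by (auto simp: F_def RCOSETS_def)
  have gG: "g \<in> carrier G" using g assms subgroup.mem_carrier by metis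
  have "g \<notin> D" using C g subgroup.rcos_const[OF D P.is_group] by auto
  moreover have "g \<otimes> d \<otimes> inv g \<in> D" if "d \<in> D" for d
  proof -
    have "d \<in> P" using that assms by auto
    then have "g \<otimes>\<^bsub>?P\<^esub> d \<otimes>\<^bsub>?P\<^esub> inv\<^bsub>?P\<^esub> g \<in> D"
      using P.rcoset_conj_mem[OF D, of g d] g C that by (auto simp: F_def)
    then show ?thesis using m_inv_consistent[OF assms(3) g(1)] by simp
  qed
  then have "g \<in> normalizer G D"
    using gG finP assms subgroup.subset
    by (intro mem_normalizerI) (auto simp: finite_subset psubset_imp_subset)
  ultimately show thesis using that g by blast
qed

end

section \<open>Normal \<open>p\<close>-subgroups of \<open>p\<close>-supersolvable groups\<close>

text \<open>The local condition that drives the fusion argument: each normalizer of a nontrivial \<open>p\<close>-subgroup \<open>D\<close>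
induces on \<open>D\<close> only automorphisms that come from a Sylow \<open>p\<close>-subgroup.\<close>

definition normalizers_factorize :: "nat \<Rightarrow> ('a, 'b) monoid_scheme \<Rightarrow> bool"
  where "normalizers_factorize p G \<longleftrightarrow>
    (\<forall>D n S. subgroup D G \<longrightarrow> card D = p ^ n \<longrightarrow> D \<noteq> {\<one>\<^bsub>G\<^esub>} \<longrightarrow>
      sylow_subgroup p (G\<lparr>carrier := normalizer G D\<rparr>) S \<longrightarrow>
      normalizer G D \<subseteq> centralizer G D <#>\<^bsub>G\<^esub> S)"

lemma normalizers_factorizeD:
  "normalizers_factorize p G \<Longrightarrow> subgroup D G \<Longrightarrow> card D = p ^ n \<Longrightarrow> D \<noteq> {\<one>\<^bsub>G\<^esub>} \<Longrightarrow>
    sylow_subgroup p (G\<lparr>carrier := normalizer G D\<rparr>) S \<Longrightarrow>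
    normalizer G D \<subseteq> centralizer G D <#>\<^bsub>G\<^esub> S"
  unfolding normalizers_factorize_def by blast

context group
begin

lemma order_chief_quotient:
  assumes "K \<lhd> G" "L \<lhd> G" "L \<subseteq> K"
  shows "order (chief_quotient G K L) * card L = card K"
proof -
  have K: "subgroup K G" using assms normal_imp_subgroup by blast
  interpret K: group "G\<lparr>carrier := K\<rparr>" using K subgroup_imp_group by blast
  have "subgroup L (G\<lparr>carrier := K\<rparr>)"
    using K assms normal_imp_subgroup subgroup_incl by blast
  then show ?thesis using K.lagrange[of L] by (simp add: FactGroup_def order_def)
qed

lemma conjugate_set_consistent:
  assumes "subgroup N G" "g \<in> N"
  shows "conjugate_set (G\<lparr>carrier := N\<rparr>) g A = conjugate_set G g A"
  using m_inv_consistent[OF assms] by (simp add: conjugate_set_def)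

lemma sylow_subgroup_restrict:
  assumes "sylow_subgroup p G P" "subgroup N G" "P \<subseteq> N" "finite (carrier G)"
  shows "sylow_subgroup p (G\<lparr>carrier := N\<rparr>) P"
proof -
  note P = sylow_subgroupD[OF assms(1)]
  interpret N: group "G\<lparr>carrier := N\<rparr>" using assms subgroup_imp_group by blast
  have PN: "subgroup P (G\<lparr>carrier := N\<rparr>)" using assms P subgroup_incl by blast
  have "card N dvd order G" using lagrange[OF assms(2)] by (metis dvd_triv_right)
  moreover have "card (rcosets\<^bsub>G\<lparr>carrier := N\<rparr>\<^esub> P) * card P = card N"
    using N.lagrange[OF PN] by (simp add: order_def)
  ultimately have "card (rcosets\<^bsub>G\<lparr>carrier := N\<rparr>\<^esub> P) * card P dvd card (rcosets P) * card P"
    using P(1) by (simp add: mult.commute)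
  moreover have "card P \<noteq> 0"
    using assms(4) P(1) order_gt_0_iff_finite by (metis mult_0 less_irrefl)
  ultimately have "card (rcosets\<^bsub>G\<lparr>carrier := N\<rparr>\<^esub> P) dvd card (rcosets P)" by simp
  then show ?thesis using P PN dvd_trans unfolding sylow_subgroup_def by blast
qed

text \<open>No prime divides the index of \<open>M\<close>.\<close>

lemma eq_carrier_if_sylow_subgroups:
  assumes "finite (carrier G)" "subgroup M G"
    and "\<And>r. prime r \<Longrightarrow> \<exists>R. sylow_subgroup r G R \<and> R \<subseteq> M"
  shows "M = carrier G"
proof (rule ccontr)
  assume "M \<noteq> carrier G"
  then have "card M \<noteq> order G"
    using assms card_subset_eq subgroup.subset unfolding order_def by blast
  then have "card (rcosets M) \<noteq> 1" using lagrange[OF assms(2)] by auto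
  then obtain r where r: "prime r" "r dvd card (rcosets M)" using prime_factor_nat by blast
  then obtain R where R: "sylow_subgroup r G R" "R \<subseteq> M" using assms(3) by blast
  note RG = sylow_subgroupD[OF R(1)]
  have "card R dvd card M" using card_subgroup_dvd RG assms R by blast
  then have "card (rcosets M) * card R dvd card (rcosets R) * card R"
    using lagrange[OF assms(2)] RG(1) by (metis dvd_refl mult.commute mult_dvd_mono)
  moreover have "card R \<noteq> 0"
    using assms(1) RG(1) order_gt_0_iff_finite by (metis mult_0 less_irrefl)
  ultimately have "card (rcosets M) dvd card (rcosets R)" by simp
  then show False using r RG dvd_trans by blast
qed

lemma centralizer_normal:
  assumes "D \<lhd> G"
  shows "centralizer G D \<lhd> G"
proof (rule normal_invI)
  interpret D: normal D G by fact
  show "subgroup (centralizer G D) G" using subgroup_centralizer D.subset by blast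
  fix g c assume g: "g \<in> carrier G" and c: "c \<in> centralizer G D"
  have cG: "c \<in> carrier G" using c by (simp add: centralizer_def)
  have "g \<otimes> c \<otimes> inv g \<otimes> d = d \<otimes> (g \<otimes> c \<otimes> inv g)" if d: "d \<in> D" for d
  proof -
    have dG: "d \<in> carrier G" using d D.subset by blast
    define e where "e = inv g \<otimes> d \<otimes> g"
    have e: "e \<in> D" "e \<in> carrier G" using D.inv_op_closed1[OF g d] g dG by (auto simp: e_def)
    have d_eq: "d = g \<otimes> e \<otimes> inv g" using g dG by (simp add: e_def m_assoc) (simp add: m_assoc[symmetric])
    have ce: "c \<otimes> e = e \<otimes> c" using c e by (simp add: centralizer_def)
    have "g \<otimes> c \<otimes> inv g \<otimes> d = g \<otimes> (c \<otimes> e) \<otimes> inv g"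
      unfolding d_eq using g cG e by (simp add: m_assoc) (simp add: m_assoc[symmetric])
    also have "\<dots> = d \<otimes> (g \<otimes> c \<otimes> inv g)"
      unfolding d_eq ce using g cG e by (simp add: m_assoc) (simp add: m_assoc[symmetric])
    finally show ?thesis .
  qed
  then show "g \<otimes> c \<otimes> inv g \<in> centralizer G D" using g cG by (simp add: centralizer_def)
qed

text \<open>By induction along a chief series of \<open>G\<close> below \<open>D\<close>. Let \<open>D / D'\<close> be a chief factor; it has order \<open>p\<close>,
and \<open>R\<close> centralizes \<open>D'\<close>. So the subgroup \<open>C\<close> of the fixed points of \<open>R\<close> in \<open>D\<close> is \<open>D'\<close> or \<open>D\<close>. But \<open>r\<close>
divides the number \<open>card D - card C\<close> of moved points, and \<open>card D - card D' = (p - 1) * card D'\<close>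
is prime to \<open>r\<close> since \<open>r > p\<close>. This last step is where \<open>p\<close> has to be the least prime.\<close>

lemma p_supersolvable_centralizes:
  assumes ss: "p_supersolvable p G" and p: "prime p"
    and least: "\<And>q. prime q \<Longrightarrow> q dvd order G \<Longrightarrow> p \<le> q"
    and r: "prime r" "r \<noteq> p" and R: "subgroup R G" "card R = r ^ j"
    and "D \<lhd> G" "card D = p ^ k"
  shows "R \<subseteq> centralizer G D"
  using \<open>D \<lhd> G\<close> \<open>card D = p ^ k\<close>
proof (induction k arbitrary: D rule: less_induct)
  case (less k)
  have finG: "finite (carrier G)" using ss by (simp add: p_supersolvable_def)
  have RG: "R \<subseteq> carrier G" using R subgroup.subset by blast
  have DG: "D \<subseteq> carrier G" "subgroup D G"
    using less.prems normal_imp_subgroup subgroup.subset by blast+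
  have finD: "finite D" using DG finG finite_subset by blast
  show ?case
  proof (cases "D = {\<one>}")
    case True
    then show ?thesis using RG by (auto simp: centralizer_def)
  next
    case nontriv: False
    define Ms where "Ms = {M. M \<lhd> G \<and> M \<subset> D}"
    have "{\<one>} \<in> Ms" using nontriv one_is_normal subgroup.one_closed[OF DG(2)] by (auto simp: Ms_def)
    moreover have "finite Ms" using finD by (auto intro: finite_subset[of _ "Pow D"] simp: Ms_def)
    ultimately obtain D' where D': "D' \<in> Ms" "\<And>M. M \<in> Ms \<Longrightarrow> D' \<subseteq> M \<Longrightarrow> D' = M"
      by (metis finite_has_maximal empty_iff)
    have D'n: "D' \<lhd> G" "D' \<subset> D" "subgroup D' G"
      using D'(1) normal_imp_subgroup by (auto simp: Ms_def)
    have chief: "chief_factor G D D'"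
      using D' D'n less.prems(1) by (auto simp: chief_factor_def Ms_def)
    define i where "i = order (chief_quotient G D D')"
    have i: "i * card D' = p ^ k"
      using order_chief_quotient[OF less.prems(1) D'n(1)] D'n(2) less.prems(2) by (auto simp: i_def)
    have "card D' dvd p ^ k" "i dvd p ^ k" using i by (metis dvd_triv_left dvd_triv_right)+
    then obtain k' l where k': "card D' = p ^ k'" and l: "i = p ^ l"
      using p by (auto simp: divides_primepow_nat)
    have card_less: "card D' < p ^ k" using psubset_card_mono[OF finD D'n(2)] less.prems by simp
    then have "k' < k" using k' prime_gt_1_nat[OF p] by simp
    have "p dvd i" using card_less i l by (cases l) auto
    then have "i = p"
      using ss chief by (auto simp: p_supersolvable_def is_p'_group_def i_def)
    then have cardD: "card D = p * card D'" using i less.prems by simp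
    show ?thesis
    proof (cases "j = 0")
      case True
      then have "R = {\<one>}"
        using R subgroup.one_closed[OF R(1)] by (auto simp: card_1_singleton_iff)
      then show ?thesis using DG by (auto simp: centralizer_def)
    next
      case False
      have "r dvd order G"
        using lagrange[OF R(1)] R(2) False by (metis dvd_mult dvd_power neq0_conv)
      then have "p < r" using least[OF r(1)] r(2) by simp
      define C where "C = D \<inter> centralizer G R"
      have C: "subgroup C G" "C \<subseteq> D"
        using DG subgroup_centralizer[OF RG] subgroups_Inter_pair by (auto simp: C_def)
      have "R \<subseteq> centralizer G D'" using less.IH[OF \<open>k' < k\<close> D'n(1) k'] .
      then have comm: "d \<otimes> x = x \<otimes> d" if "d \<in> D'" "x \<in> R" for d x
        using that by (auto simp: centralizer_def)
      have "D' \<subseteq> D" "D' \<subseteq> carrier G" using D'n(2) DG by auto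
      then have "D' \<subseteq> C" using comm unfolding C_def centralizer_def by blast
      have "r dvd card {d \<in> D. \<exists>x \<in> carrier (G\<lparr>carrier := R\<rparr>). x \<otimes> d \<otimes> inv x \<noteq> d}"
      proof (rule p_group_moved_points_dvd[OF subgroup_imp_group[OF R(1)] r(1) _ finD])
        show "order (G\<lparr>carrier := R\<rparr>) = r ^ j" using R by (simp add: order_def)
        fix d assume d: "d \<in> D"
        then have dG: "d \<in> carrier G" using DG by blast
        then show "\<one>\<^bsub>G\<lparr>carrier := R\<rparr>\<^esub> \<otimes> d \<otimes> inv \<one>\<^bsub>G\<lparr>carrier := R\<rparr>\<^esub> = d" by simp
        fix x assume "x \<in> carrier (G\<lparr>carrier := R\<rparr>)"
        then have x: "x \<in> carrier G" using RG by auto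
        then show "x \<otimes> d \<otimes> inv x \<in> D" using d normal.inv_op_closed2[OF less.prems(1)] by blast
        fix y assume "y \<in> carrier (G\<lparr>carrier := R\<rparr>)"
        then have y: "y \<in> carrier G" using RG by auto
        show "x \<otimes>\<^bsub>G\<lparr>carrier := R\<rparr>\<^esub> y \<otimes> d \<otimes> inv (x \<otimes>\<^bsub>G\<lparr>carrier := R\<rparr>\<^esub> y)
            = x \<otimes> (y \<otimes> d \<otimes> inv y) \<otimes> inv x"
          using x y dG by (simp add: inv_mult_group m_assoc)
      qed
      also have "{d \<in> D. \<exists>x \<in> carrier (G\<lparr>carrier := R\<rparr>). x \<otimes> d \<otimes> inv x \<noteq> d} = D - C"
      proof -
        have "x \<otimes> d \<otimes> inv x = d \<longleftrightarrow> d \<otimes> x = x \<otimes> d" if "x \<in> R" "d \<in> D" for x d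
          using that RG DG inv_solve_right[of d "x \<otimes> d" x] by (metis m_closed subsetD)
        then show ?thesis using DG by (auto simp: C_def centralizer_def)
      qed
      also have "card (D - C) = card D - card C"
        using C finD by (simp add: card_Diff_subset finite_subset)
      finally have r_dvd: "r dvd card D - card C" .
      obtain m where m: "card C = card D' * m"
        using card_subgroup_dvd[OF D'n(3) C(1) \<open>D' \<subseteq> C\<close>] by (auto elim: dvdE)
      have "card C dvd card D" using card_subgroup_dvd[OF C(1) DG(2) C(2)] .
      then have "m dvd p" using m cardD k' p by auto
      then have "m = 1 \<or> m = p" using p by (simp add: prime_nat_iff)
      moreover have "m \<noteq> 1"
      proof
        assume "m = 1"
        then have "r dvd (p - 1) * p ^ k'" using r_dvd m cardD k' by (simp add: algebra_simps)
        then have "r dvd p - 1 \<or> r dvd p ^ k'" using r by (simp add: prime_dvd_mult_iff)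
        moreover have "\<not> r dvd p ^ k'"
          using r p by (metis prime_dvd_power primes_dvd_imp_eq)
        moreover have "\<not> r dvd p - 1"
          using \<open>p < r\<close> prime_gt_1_nat[OF p] by (auto dest!: dvd_imp_le)
        ultimately show False by blast
      qed
      ultimately have "card C = card D" using m cardD by simp
      then have "C = D" using C finD card_subset_eq by blast
      then have "D \<subseteq> centralizer G R" by (auto simp: C_def)
      then have "d \<otimes> x = x \<otimes> d" if "d \<in> D" "x \<in> R" for d x
        using that by (auto simp: centralizer_def)
      then show ?thesis using RG by (auto simp: centralizer_def)
    qed
  qed
qed

text \<open>The right factor supplies a Sylow \<open>p\<close>-subgroup and the left one, by the preceding lemma, Sylow
subgroups for all other primes.\<close>

lemma p_supersolvable_factorization:
  assumes "p_supersolvable p G" "prime p" "\<And>q. prime q \<Longrightarrow> q dvd order G \<Longrightarrow> p \<le> q"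
    and D: "D \<lhd> G" "card D = p ^ k" and Q: "sylow_subgroup p G Q"
  shows "centralizer G D <#> Q = carrier G"
proof (rule eq_carrier_if_sylow_subgroups)
  show fin: "finite (carrier G)" using assms(1) by (simp add: p_supersolvable_def)
  have DG: "D \<subseteq> carrier G" using D normal_imp_subgroup subgroup.subset by blast
  note QG = sylow_subgroupD[OF Q]
  interpret second_isomorphism_grp "centralizer G D" G Q
    using centralizer_normal[OF D(1)] QG(2)
    by (simp add: second_isomorphism_grp_def second_isomorphism_grp_axioms_def)
  show "subgroup (centralizer G D <#> Q) G" by (rule normal_set_mult_subgroup)
  fix r :: nat assume r: "prime r"
  show "\<exists>R. sylow_subgroup r G R \<and> R \<subseteq> centralizer G D <#> Q"
  proof (cases "r = p")
    case True
    then show ?thesis using Q S_contained_in_set_mult by blast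
  next
    case False
    obtain R where R: "sylow_subgroup r G R" using sylow_subgroup_exists[OF fin r] .
    have "R \<subseteq> centralizer G D"
      using p_supersolvable_centralizes[OF assms(1-3) r False _ _ D] sylow_subgroupD[OF R] by metis
    then show ?thesis using R H_contained_in_set_mult by blast
  qed
qed

section \<open>Control of fusion by a Sylow subgroup\<close>

lemma subgroup_le_normalizer:
  assumes "subgroup D G"
  shows "D \<subseteq> normalizer G D"
  using subgroup.subset[OF normal_imp_subgroup[OF subgroup_in_normalizer[OF assms]]] by simp

lemma mem_centralizerI_subset:
  assumes "c \<in> centralizer G B" "A \<subseteq> B"
  shows "c \<in> centralizer G A"
  using assms centralizer_antimono by blast

text \<open>Frobenius' argument, by descending induction on the order of \<open>D = P \<inter> Q\<close>. Let \<open>N\<close> be the normalizer of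
\<open>D\<close>. If \<open>D\<close> is neither trivial nor all of \<open>P\<close>, then \<open>P \<inter> N\<close> and \<open>Q \<inter> N\<close> are larger than \<open>D\<close> and lie in
Sylow subgroups \<open>S\<close> and \<open>S'\<close> of \<open>N\<close>. The factorization of \<open>N\<close> provides \<open>c\<close> in the centralizer of \<open>D\<close>
with \<open>S' = c S (inv c)\<close>. If \<open>R\<close> is a Sylow subgroup of \<open>G\<close> above \<open>S\<close>, then \<open>P \<inter> R\<close> and \<open>c R (inv c) \<inter> Q\<close> are
larger than \<open>D\<close>, so that the induction hypothesis connects \<open>P\<close> to \<open>R\<close> and \<open>c R (inv c)\<close> to \<open>Q\<close> by elements
that centralize \<open>D\<close>.\<close>

lemma sylow_subgroups_conjugate_in_centralizer:
  assumes fin: "finite (carrier G)" and p: "prime p"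
    and factor: "normalizers_factorize p G"
    and "sylow_subgroup p G P" "sylow_subgroup p G Q"
  shows "\<exists>c \<in> centralizer G (P \<inter> Q). conjugate_set G c Q = P"
  using assms(4,5)
proof (induction "card P - card (P \<inter> Q)" arbitrary: P Q rule: less_induct)
  case less
  note P = sylow_subgroupD[OF less.prems(1)] and Q = sylow_subgroupD[OF less.prems(2)]
  have card_eq: "card S = card P" if "sylow_subgroup p G S" for S
    using that less.prems sylow_subgroup_card[OF fin p] by simp
  have finP: "finite P" "finite Q" using P Q fin subgroup.subset finite_subset by metis+
  define D where "D = P \<inter> Q"
  have D: "subgroup D G" using P Q subgroups_Inter_pair by (simp add: D_def)
  have DG: "D \<subseteq> carrier G" using D subgroup.subset by blast
  consider "D = P" | "D = {\<one>}" | "D \<subset> P" "D \<noteq> {\<one>}" by (auto simp: D_def)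
  then show ?case
  proof cases
    case 1
    then have "P \<subseteq> Q" by (auto simp: D_def)
    then have "P = Q" using card_eq[OF less.prems(2)] finP by (simp add: card_subset_eq)
    then have "conjugate_set G \<one> Q = P" using P subgroup.subset conjugate_set_one by blast
    moreover have "\<one> \<in> centralizer G (P \<inter> Q)"
      using subgroup_centralizer[OF DG] subgroup.one_closed by (auto simp: D_def)
    ultimately show ?thesis by blast
  next
    case 2
    obtain g where "g \<in> carrier G" "conjugate_set G g Q = P"
      using sylow_subgroups_conjugate[OF fin p less.prems(2,1)] .
    then show ?thesis using 2 by (auto simp: D_def centralizer_def)
  next
    case 3
    have "D \<subset> Q"
      using 3 card_eq[OF less.prems(2)] finP card_subset_eq[of P Q] by (auto simp: D_def)
    obtain a b where a: "card P = p ^ a" and b: "card Q = p ^ b" using P Q by blast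
    have "card D dvd p ^ a" using card_subgroup_dvd[OF D P(2)] a by (auto simp: D_def)
    then obtain d where d: "card D = p ^ d" using p by (auto simp: divides_primepow_nat)
    define N where "N = normalizer G D"
    have N: "subgroup N G" using normalizer_imp_subgroup[OF DG] by (simp add: N_def)
    let ?N = "G\<lparr>carrier := N\<rparr>"
    interpret N: group ?N using N subgroup_imp_group by blast
    have finN: "finite (carrier ?N)" using N fin subgroup.subset finite_subset by fastforce
    have DN: "D \<subseteq> N" using subgroup_le_normalizer[OF D] by (simp add: N_def)
    have sylow_N: "\<exists>S R. sylow_subgroup p ?N S \<and> A \<inter> N \<subseteq> S \<and> S \<subseteq> R \<and> sylow_subgroup p G R"
      and grows: "D \<subset> A \<inter> N"
      if A: "subgroup A G" "card A = p ^ n" "D \<subset> A" for A n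
    proof -
      have AN: "subgroup (A \<inter> N) G" using A N subgroups_Inter_pair by blast
      have "card (A \<inter> N) dvd p ^ n" using card_subgroup_dvd[OF AN A(1)] A(2) by simp
      then obtain m where m: "card (A \<inter> N) = p ^ m" using p by (auto simp: divides_primepow_nat)
      have "subgroup (A \<inter> N) ?N" using AN N subgroup_incl by blast
      then obtain S where S: "sylow_subgroup p ?N S" "A \<inter> N \<subseteq> S"
        using N.p_subgroup_le_sylow_subgroup[OF finN p] m by metis
      have "subgroup S G" using S N.sylow_subgroupD(2) N incl_subgroup by blast
      moreover obtain m' where "card S = p ^ m'" using S N.sylow_subgroupD(4) by blast
      ultimately obtain R where "sylow_subgroup p G R" "S \<subseteq> R"
        using p_subgroup_le_sylow_subgroup[OF fin p] by blast
      then show "\<exists>S R. sylow_subgroup p ?N S \<and> A \<inter> N \<subseteq> S \<and> S \<subseteq> R \<and> sylow_subgroup p G R"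
        using S by blast
      obtain g where "g \<in> A" "g \<notin> D" "g \<in> N"
        using p_group_normalizer_grows[OF fin p A(1,2) D A(3)] by (auto simp: N_def)
      then show "D \<subset> A \<inter> N" using A DN by blast
    qed
    obtain S R where S: "sylow_subgroup p ?N S" "P \<inter> N \<subseteq> S" "S \<subseteq> R" "sylow_subgroup p G R"
      using sylow_N[OF P(2) a 3(1)] by blast
    obtain S' where S': "sylow_subgroup p ?N S'" "Q \<inter> N \<subseteq> S'"
      using sylow_N[OF Q(2) b \<open>D \<subset> Q\<close>] by blast
    obtain n where n: "n \<in> N" "conjugate_set ?N n S = S'"
      using N.sylow_subgroups_conjugate[OF finN p S(1) S'(1)] by auto
    have SG: "subgroup S G" "S \<subseteq> carrier G"
      using S(1) N.sylow_subgroupD(2) N incl_subgroup subgroup.subset by blast+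
    obtain c s where c: "c \<in> centralizer G D" and s: "s \<in> S" and ncs: "n = c \<otimes> s"
      using normalizers_factorizeD[OF factor D d 3(2)] S(1) n(1) unfolding N_def set_mult_def by blast
    have cG: "c \<in> carrier G" "s \<in> carrier G" using c s SG by (auto simp: centralizer_def)
    \<comment> \<open>As \<open>s\<close> normalizes \<open>S\<close>, the conjugating element can be taken in the centralizer.\<close>
    have "conjugate_set G s S = S"
      using s subgroup_le_normalizer[OF SG(1)] mem_normalizer_iff[OF SG(2)] by blast
    then have S'_eq: "S' = conjugate_set G c S"
      using n conjugate_set_consistent[OF N n(1)] conjugate_set_mult[OF cG SG(2)] ncs by simp
    define R' where "R' = conjugate_set G c R"
    have R': "sylow_subgroup p G R'"
      using sylow_subgroup_conjugate_set[OF fin p S(4) cG(1)] by (simp add: R'_def)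
    have "S' \<subseteq> R'" using conjugate_set_mono[OF S(3)] S'_eq by (simp add: R'_def)
    have "D \<subset> P \<inter> R" using grows[OF P(2) a 3(1)] S by blast
    then have "card P - card (P \<inter> R) < card P - card (P \<inter> Q)"
      using finP psubset_card_mono[of "P \<inter> R" D] card_mono[of P "P \<inter> R"]
      by (simp add: D_def)
    then obtain c1 where c1: "c1 \<in> centralizer G (P \<inter> R)" "conjugate_set G c1 R = P"
      using less.hyps[OF _ less.prems(1) S(4)] by blast
    have "D \<subset> R' \<inter> Q" using grows[OF Q(2) b \<open>D \<subset> Q\<close>] S'(2) \<open>S' \<subseteq> R'\<close> by blast
    moreover have "finite R'" using R' sylow_subgroupD(2) fin subgroup.subset finite_subset by metis
    ultimately have "card R' - card (R' \<inter> Q) < card P - card (P \<inter> Q)"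
      using card_eq[OF R'] psubset_card_mono[of "R' \<inter> Q" D] card_mono[of R' "R' \<inter> Q"]
      by (simp add: D_def)
    then obtain c2 where c2: "c2 \<in> centralizer G (R' \<inter> Q)" "conjugate_set G c2 Q = R'"
      using less.hyps[OF _ R' less.prems(2)] by blast
    have cs: "c1 \<in> centralizer G D" "c2 \<in> centralizer G D"
      using c1 c2 \<open>D \<subset> P \<inter> R\<close> \<open>D \<subset> R' \<inter> Q\<close> mem_centralizerI_subset by blast+
    interpret CD: subgroup "centralizer G D" G by (rule subgroup_centralizer[OF DG])
    have G: "c1 \<in> carrier G" "c2 \<in> carrier G" "Q \<subseteq> carrier G" "R \<subseteq> carrier G"
      using cs CD.subset subgroup.subset[OF Q(2)] subgroup.subset[OF sylow_subgroupD(2)[OF S(4)]]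
      by auto
    have "conjugate_set G (inv c) R' = R"
      unfolding R'_def using conjugate_set_inv(1) cG G by blast
    then have "conjugate_set G (c1 \<otimes> inv c \<otimes> c2) Q = P"
      using c1(2) c2(2) cG G conjugate_set_closed[OF cG(1) G(4)]
      by (simp add: conjugate_set_mult[symmetric] R'_def[symmetric])
    moreover have "c1 \<otimes> inv c \<otimes> c2 \<in> centralizer G D" using cs c by simp
    ultimately show ?thesis by (auto simp: D_def)
  qed
qed

text \<open>If \<open>x\<close> and \<open>y = g x (inv g)\<close> lie in \<open>P\<close>, then \<open>y\<close> lies in \<open>P\<close> and in \<open>Q = g P (inv g)\<close>. An element \<open>c\<close>
that carries \<open>Q\<close> to \<open>P\<close> and fixes \<open>y\<close> turns \<open>g\<close> into an element \<open>c g\<close> of the normalizer of \<open>P\<close> that still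
sends \<open>x\<close> to \<open>y\<close>, and the normalizer of \<open>P\<close> acts on \<open>P\<close> like \<open>P\<close> itself.\<close>

lemma sylow_subgroup_controls_fusion:
  assumes fin: "finite (carrier G)" and p: "prime p"
    and factor: "normalizers_factorize p G"
    and P: "sylow_subgroup p G P"
    and x: "x \<in> P" and g: "g \<in> carrier G" and y: "g \<otimes> x \<otimes> inv g \<in> P"
  shows "\<exists>u \<in> P. u \<otimes> x \<otimes> inv u = g \<otimes> x \<otimes> inv g"
proof (cases "P = {\<one>}")
  case True
  then show ?thesis using x g by simp
next
  case False
  note PG = sylow_subgroupD[OF P]
  have PC: "P \<subseteq> carrier G" using PG subgroup.subset by blast
  have xG: "x \<in> carrier G" using x PC by blast
  define Q where "Q = conjugate_set G g P"
  have Q: "sylow_subgroup p G Q" using sylow_subgroup_conjugate_set[OF fin p P g] by (simp add: Q_def)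
  then obtain c where c: "c \<in> centralizer G (P \<inter> Q)" "conjugate_set G c Q = P"
    using sylow_subgroups_conjugate_in_centralizer[OF fin p factor P] by blast
  have cG: "c \<in> carrier G" using c by (simp add: centralizer_def)
  have "conjugate_set G (c \<otimes> g) P = P" using c cG g PC by (simp add: Q_def conjugate_set_mult)
  then have cg: "c \<otimes> g \<in> normalizer G P" using mem_normalizer_iff[OF PC] cG g by simp
  have PN: "sylow_subgroup p (G\<lparr>carrier := normalizer G P\<rparr>) P"
    using sylow_subgroup_restrict[OF P normalizer_imp_subgroup[OF PC] _ fin]
      subgroup_le_normalizer[OF PG(2)] by blast
  obtain k u where k: "k \<in> centralizer G P" and u: "u \<in> P" and cg_eq: "c \<otimes> g = k \<otimes> u"
    using normalizers_factorizeD[OF factor PG(2) _ False PN] PG(4) cg unfolding set_mult_def by blast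
  have kG: "k \<in> carrier G" "u \<in> carrier G" using k u PC by (auto simp: centralizer_def)
  have "g \<otimes> x \<otimes> inv g \<in> P \<inter> Q" using x y by (auto simp: Q_def conjugate_set_def)
  then have "g \<otimes> x \<otimes> inv g = c \<otimes> (g \<otimes> x \<otimes> inv g) \<otimes> inv c"
    by (rule centralizer_conj[OF c(1) _ le_infI1[OF PC], symmetric])
  also have "\<dots> = (c \<otimes> g) \<otimes> x \<otimes> inv (c \<otimes> g)"
    using cG g xG by (simp add: inv_mult_group m_assoc)
  also have "\<dots> = k \<otimes> (u \<otimes> x \<otimes> inv u) \<otimes> inv k"
    unfolding cg_eq using kG xG by (simp add: inv_mult_group m_assoc)
  also have "\<dots> = u \<otimes> x \<otimes> inv u"
    by (rule centralizer_conj[OF k _ PC]) (use u x PG(2) in \<open>blast intro: subgroup.m_closed subgroup.m_inv_closed\<close>)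
  finally show ?thesis using u by metis
qed

section \<open>Transfer\<close>

text \<open>The transfer \<open>V g\<close> is the product of \<open>lam (r C \<otimes> g \<otimes> inv (r (C #> g)))\<close> over the right cosets \<open>C\<close> of \<open>P\<close>,
for any choice of representatives \<open>r C \<in> C\<close>. Its value on \<open>x \<in> P\<close> is usually computed from the cycles of
\<open>x\<close> on the cosets. A choice of representatives that is adapted to the double cosets is quicker: let
\<open>r C = t C \<otimes> s C\<close>, where \<open>t C\<close> depends only on the double coset \<open>C <#> P\<close> and \<open>s C\<close> lies in \<open>P\<close>. For
\<open>x \<in> P\<close> the factor of \<open>C\<close> is then the conjugate by \<open>t C\<close> of \<open>s C \<otimes> x \<otimes> inv (s (C #> x))\<close>, which lies in
\<open>P\<close>. As \<open>lam\<close> is constant on \<open>G\<close>-classes in \<open>P\<close>, the product telescopes to a power of \<open>lam x\<close>.\<close>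

lemma exists_transfer:
  assumes fin: "finite (carrier G)" and P: "subgroup P G" and "comm_group A"
    and lam: "lam \<in> hom (G\<lparr>carrier := P\<rparr>) A"
    and fusion: "\<And>g x. g \<in> carrier G \<Longrightarrow> x \<in> P \<Longrightarrow> g \<otimes> x \<otimes> inv g \<in> P \<Longrightarrow>
      lam (g \<otimes> x \<otimes> inv g) = lam x"
  shows "\<exists>V \<in> hom G A. \<forall>x \<in> P. V x = lam x [^]\<^bsub>A\<^esub> card (rcosets P)"
proof -
  interpret A: comm_group A by fact
  interpret PG: subgroup P G by fact
  interpret P: group "G\<lparr>carrier := P\<rparr>" using P subgroup_imp_group by blast
  interpret lam: group_hom "G\<lparr>carrier := P\<rparr>" A lam
    by unfold_locales (rule lam)
  have lam_closed: "lam x \<in> carrier A" if "x \<in> P" for x using that lam.hom_closed by simp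
  have lam_mult: "lam (x \<otimes> y) = lam x \<otimes>\<^bsub>A\<^esub> lam y" if "x \<in> P" "y \<in> P" for x y
    using that lam.hom_mult by simp
  let ?R = "rcosets P"
  have finR: "finite ?R" using fin finite_rcosets by blast
  have RG: "C \<subseteq> carrier G" if "C \<in> ?R" for C using PG.rcosets_carrier[OF is_group that] .
  define t where "t C = (SOME y. y \<in> C <#> P)" for C
  have t_mem: "t C \<in> C <#> P" if C: "C \<in> ?R" for C
  proof -
    obtain c where "c \<in> C" using PG.rcosets_non_empty[OF C] by blast
    then have "c \<otimes> \<one> \<in> C <#> P" unfolding set_mult_def using PG.one_closed by blast
    then show ?thesis unfolding t_def by (rule someI)
  qed
  have t_shift: "t (C #> x) = t C" if "C \<in> ?R" "x \<in> P" for C x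
  proof -
    have "(C #> x) <#> P = C <#> (x <# P)"
      using rcos_assoc_lcos[OF RG[OF that(1)] PG.subset, of x] that by simp
    also have "x <# P = P" using coset_join3[OF _ P that(2)] that by simp
    finally show ?thesis by (simp add: t_def)
  qed
  have "\<exists>q \<in> P. t C \<otimes> q \<in> C" if C: "C \<in> ?R" for C
  proof -
    obtain c q where cq: "c \<in> C" "q \<in> P" "t C = c \<otimes> q"
      using t_mem[OF C] by (auto simp: set_mult_def)
    then have "t C \<otimes> inv q = c" using RG[OF C] by (auto simp: m_assoc)
    then show ?thesis using cq by (metis PG.m_inv_closed)
  qed
  then obtain s where s: "\<And>C. C \<in> ?R \<Longrightarrow> s C \<in> P" "\<And>C. C \<in> ?R \<Longrightarrow> t C \<otimes> s C \<in> C"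
    by metis
  have tG: "t C \<in> carrier G" if "C \<in> ?R" for C
    using t_mem[OF that] RG[OF that] by (auto simp: set_mult_def)
  define r where "r C = t C \<otimes> s C" for C
  have r: "r C \<in> C" "r C \<in> carrier G" if "C \<in> ?R" for C
    using s(2)[OF that] RG[OF that] by (auto simp: r_def)
  have shift: "C #> g \<in> ?R" if "C \<in> ?R" "g \<in> carrier G" for C g
    using rcosets_closed[OF P that] .
  define w where "w C g = r C \<otimes> g \<otimes> inv (r (C #> g))" for C g
  have w: "w C g \<in> P" if C: "C \<in> ?R" and g: "g \<in> carrier G" for C g
  proof -
    have "r C \<otimes> g \<in> C #> g" using r[OF C] by (auto simp: r_coset_def)
    moreover obtain b where b: "b \<in> carrier G" "C #> g = P #> b"
      using shift[OF C g] by (auto simp: RCOSETS_def)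
    moreover have "P #> b = P #> r (C #> g)"
      using repr_independence[OF _ b(1) P] r(1)[OF shift[OF C g]] unfolding b(2) .
    ultimately have "r C \<otimes> g \<in> P #> r (C #> g)" by metis
    then show ?thesis
      unfolding w_def by (rule PG.rcos_module_imp[OF is_group r(2)[OF shift[OF C g]]])
  qed
  have bij: "inj_on (\<lambda>C. C #> g) ?R \<and> (\<lambda>C. C #> g) ` ?R = ?R" if g: "g \<in> carrier G" for g
  proof -
    have "inj_on (\<lambda>C. C #> g) ?R"
    proof (rule inj_on_inverseI)
      fix C assume "C \<in> ?R"
      then show "C #> g #> inv g = C" using RG g by (simp add: coset_mult_assoc)
    qed
    moreover have "(\<lambda>C. C #> g) ` ?R \<subseteq> ?R" using shift g by blast
    ultimately show ?thesis using finR by (simp add: card_image card_subset_eq)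
  qed
  have reindex: "finprod A (\<lambda>C. f (C #> g)) ?R = finprod A f ?R"
    if "g \<in> carrier G" "f \<in> ?R \<rightarrow> carrier A" for f g
    using A.finprod_reindex[of f "\<lambda>C. C #> g" ?R] bij[OF that(1)] that(2) by simp
  define V where "V g = finprod A (\<lambda>C. lam (w C g)) ?R" for g
  have "V \<in> hom G A"
  proof (rule homI)
    fix g h assume g: "g \<in> carrier G" and h: "h \<in> carrier G"
    have "w C (g \<otimes> h) = w C g \<otimes> w (C #> g) h" if C: "C \<in> ?R" for C
      using g h r(2)[OF C] r(2)[OF shift[OF C g]] r(2)[OF shift[OF shift[OF C g] h]] RG[OF C]
      by (simp add: w_def coset_mult_assoc m_assoc) (simp add: m_assoc[symmetric])
    then have "V (g \<otimes> h) = finprod A (\<lambda>C. lam (w C g) \<otimes>\<^bsub>A\<^esub> lam (w (C #> g) h)) ?R"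
      unfolding V_def using w g h shift
      by (intro A.finprod_cong') (auto simp: lam_mult lam_closed)
    also have "\<dots> = V g \<otimes>\<^bsub>A\<^esub> finprod A (\<lambda>C. lam (w (C #> g) h)) ?R"
      unfolding V_def using w g h shift by (intro A.finprod_multf) (auto simp: lam_closed)
    also have "finprod A (\<lambda>C. lam (w (C #> g) h)) ?R = V h"
      unfolding V_def using reindex[OF g, of "\<lambda>C. lam (w C h)"] w h by (auto simp: lam_closed)
    finally show "V (g \<otimes> h) = V g \<otimes>\<^bsub>A\<^esub> V h" .
  qed (auto simp: V_def w lam_closed intro!: A.finprod_closed)
  moreover have "V x = lam x [^]\<^bsub>A\<^esub> card ?R" if x: "x \<in> P" for x
  proof -
    have xG: "x \<in> carrier G" using x by simp
    define F where "F = finprod A (\<lambda>C. lam (s C)) ?R"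
    have F: "F \<in> carrier A" "V x \<in> carrier A"
      using s(1) w[OF _ xG] by (auto simp: F_def V_def lam_closed intro!: A.finprod_closed)
    have key: "lam (w C x) \<otimes>\<^bsub>A\<^esub> lam (s (C #> x)) = lam (s C) \<otimes>\<^bsub>A\<^esub> lam x" if C: "C \<in> ?R" for C
    proof -
      define s' where "s' = s (C #> x)"
      have s': "s' \<in> P" using s(1)[OF shift[OF C xG]] by (simp add: s'_def)
      have sC: "s C \<in> P" using s(1)[OF C] .
      define z where "z = s C \<otimes> x \<otimes> inv s'"
      have z: "z \<in> P" using sC s' x by (simp add: z_def)
      have "w C x = t C \<otimes> z \<otimes> inv (t C)"
        using tG[OF C] sC s' xG t_shift[OF C x]
        by (simp add: w_def r_def z_def s'_def[symmetric] inv_mult_group m_assoc)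
      then have "lam (w C x) = lam z"
        using fusion[OF tG[OF C] z] w[OF C xG] by simp
      moreover have "z \<otimes> s' = s C \<otimes> x"
        using sC s' xG by (simp add: z_def m_assoc)
      ultimately show ?thesis using lam_mult[OF z s'] lam_mult[OF sC x] by (simp add: s'_def)
    qed
    have "V x \<otimes>\<^bsub>A\<^esub> F = V x \<otimes>\<^bsub>A\<^esub> finprod A (\<lambda>C. lam (s (C #> x))) ?R"
      unfolding F_def using reindex[OF xG, of "\<lambda>C. lam (s C)"] s(1) by (auto simp: lam_closed)
    also have "\<dots> = finprod A (\<lambda>C. lam (w C x) \<otimes>\<^bsub>A\<^esub> lam (s (C #> x))) ?R"
      unfolding V_def using w[OF _ xG] s(1) shift[OF _ xG]
      by (intro A.finprod_multf[symmetric]) (auto simp: lam_closed)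
    also have "\<dots> = finprod A (\<lambda>C. lam (s C) \<otimes>\<^bsub>A\<^esub> lam x) ?R"
      using s(1) x by (intro A.finprod_cong') (auto simp: key lam_closed)
    also have "\<dots> = F \<otimes>\<^bsub>A\<^esub> finprod A (\<lambda>C. lam x) ?R"
      unfolding F_def using s(1) x by (intro A.finprod_multf) (auto simp: lam_closed)
    also have "finprod A (\<lambda>C. lam x) ?R = lam x [^]\<^bsub>A\<^esub> card ?R"
      by (rule A.finprod_const[OF lam_closed[OF x]])
    finally show ?thesis using F lam_closed[OF x] by (simp add: A.m_comm[of F])
  qed
  ultimately show ?thesis by blast
qed

text \<open>The centralizer of a nontrivial element has at least two elements, so it is everything.\<close>

lemma prime_order_comm_group:
  assumes "prime (order G)"
  shows "comm_group G"
proof -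
  have fin: "finite (carrier G)" using order_gt_0_iff_finite prime_gt_0_nat[OF assms] by blast
  show ?thesis
  proof (rule group_comm_groupI)
    fix a b assume a: "a \<in> carrier G" and b: "b \<in> carrier G"
    show "a \<otimes> b = b \<otimes> a"
    proof (cases "a = \<one>")
      case False
      have sub: "subgroup (centralizer G {a}) G" using subgroup_centralizer[of "{a}"] a by simp
      have "card (centralizer G {a}) dvd order G" using lagrange[OF sub] by (metis dvd_triv_right)
      moreover have "card (centralizer G {a}) \<noteq> 1"
      proof
        assume "card (centralizer G {a}) = 1"
        then obtain z where "centralizer G {a} = {z}" by (rule card_1_singletonE)
        moreover have "a \<in> centralizer G {a}" "\<one> \<in> centralizer G {a}"
          using a by (auto simp: centralizer_def)
        ultimately show False using False by simp
      qed
      ultimately have "card (centralizer G {a}) = card (carrier G)"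
        using assms unfolding prime_nat_iff order_def by blast
      then have "centralizer G {a} = carrier G"
        using card_subset_eq[OF fin subgroup.subset[OF sub]] by blast
      then have "b \<in> centralizer G {a}" using b by simp
      then show ?thesis by (simp add: centralizer_def)
    qed (use b in simp)
  qed
qed

text \<open>A subgroup of index \<open>p\<close> is properly contained in its normalizer, which is therefore everything.\<close>

lemma p_group_index_p_normal:
  assumes "finite (carrier G)" "prime p" "order G = p ^ Suc n"
  obtains M where "M \<lhd> G" "card M = p ^ n"
proof -
  obtain M where M: "subgroup M G" "card M = p ^ n"
    using sylow_thm[OF assms(2) is_group, of n p] assms by (auto simp: mult.commute)
  have "card M < card (carrier G)" using M assms prime_gt_1_nat[OF assms(2)] by (simp add: order_def)
  then have "M \<subset> carrier G" using subgroup.subset[OF M(1)] by auto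
  then obtain g where g: "g \<in> carrier G" "g \<notin> M" "g \<in> normalizer G M"
    using p_group_normalizer_grows[OF assms(1,2) subgroup_self _ M(1)] assms(3) unfolding order_def by metis
  have N: "subgroup (normalizer G M) G" "M \<subseteq> normalizer G M"
    using normalizer_imp_subgroup subgroup.subset[OF M(1)] subgroup_le_normalizer[OF M(1)] by auto
  have finN: "finite (normalizer G M)" using N(1) assms(1) subgroup.subset finite_subset by blast
  have "M \<subset> normalizer G M" using g N by blast
  then have less: "p ^ n < card (normalizer G M)" using psubset_card_mono[OF finN, of M] M by simp
  have "card (normalizer G M) dvd p ^ Suc n" using lagrange[OF N(1)] assms(3) by (metis dvd_triv_right)
  then obtain k where k: "card (normalizer G M) = p ^ k" "k \<le> Suc n"
    using divides_primepow_nat[OF assms(2)] by blast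
  then have "k = Suc n" using less prime_gt_1_nat[OF assms(2)] by (simp add: power_strict_increasing_iff)
  then have "normalizer G M = carrier G"
    using k assms(1,3) card_subset_eq subgroup.subset[OF N(1)] unfolding order_def by metis
  then show thesis using that normal_iff_normalizer[OF M(1)] M by blast
qed

text \<open>\<open>P\<close> has a quotient of order \<open>p\<close>, and the quotient map is constant on \<open>G\<close>-classes because \<open>P\<close> controls
fusion. The transfer is a power of this map on \<open>P\<close> with an exponent prime to \<open>p\<close>, hence nontrivial.\<close>

lemma exists_normal_if_fusion_controlled:
  assumes fin: "finite (carrier G)" and p: "prime p" and P: "sylow_subgroup p G P" "P \<noteq> {\<one>}"
    and fusion: "\<And>g x. g \<in> carrier G \<Longrightarrow> x \<in> P \<Longrightarrow> g \<otimes> x \<otimes> inv g \<in> P \<Longrightarrow>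
      \<exists>u \<in> P. u \<otimes> x \<otimes> inv u = g \<otimes> x \<otimes> inv g"
  obtains N where "N \<lhd> G" "N \<noteq> carrier G" "\<And>g. g \<in> carrier G \<Longrightarrow> g [^] p \<in> N"
proof -
  note PG = sylow_subgroupD[OF P(1)]
  let ?P = "G\<lparr>carrier := P\<rparr>"
  interpret PG: subgroup P G by (rule PG(2))
  interpret P: group ?P using PG subgroup_imp_group by blast
  obtain a where a: "card P = p ^ a" using PG by blast
  have "a \<noteq> 0" using a P(2) PG.one_closed card_1_singletonE[of P] by (metis power_0 singletonD)
  then obtain n where n: "card P = p ^ Suc n" using a by (cases a) auto
  have finP: "finite (carrier ?P)" using fin PG.subset finite_subset by auto
  obtain M where M: "M \<lhd> ?P" "card M = p ^ n"
    using P.p_group_index_p_normal[OF finP p, of n] n by (auto simp: order_def)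
  interpret M: normal M ?P by (rule M(1))
  define A where "A = ?P Mod M"
  have "order A * card M = card P"
    using P.lagrange[OF M.is_subgroup] by (simp add: A_def FactGroup_def order_def)
  then have ordA: "order A = p" using n M(2) p by simp
  interpret A: group A unfolding A_def by (rule M.factorgroup_is_group)
  interpret A: comm_group A using A.prime_order_comm_group ordA p by simp
  define lam where "lam x = M #>\<^bsub>?P\<^esub> x" for x
  have lam: "lam \<in> hom ?P A" unfolding lam_def A_def by (rule M.r_coset_hom_Mod)
  interpret lam: group_hom ?P A lam by unfold_locales (rule lam)
  have "lam (g \<otimes> x \<otimes> inv g) = lam x" if gx: "g \<in> carrier G" "x \<in> P" "g \<otimes> x \<otimes> inv g \<in> P" for g x
  proof -
    obtain u where u: "u \<in> P" "u \<otimes> x \<otimes> inv u = g \<otimes> x \<otimes> inv g" using fusion[OF gx] by blast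
    have uP: "u \<in> carrier ?P" and xP: "x \<in> carrier ?P" using u gx by simp_all
    have "lam (u \<otimes>\<^bsub>?P\<^esub> x \<otimes>\<^bsub>?P\<^esub> inv\<^bsub>?P\<^esub> u) = lam u \<otimes>\<^bsub>A\<^esub> lam x \<otimes>\<^bsub>A\<^esub> inv\<^bsub>A\<^esub> lam u"
      using lam.hom_mult[OF P.m_closed[OF uP xP] P.inv_closed[OF uP]] lam.hom_mult[OF uP xP]
        lam.hom_inv[OF uP] by (simp only:)
    also have "\<dots> = lam x"
      using lam.hom_closed[OF uP] lam.hom_closed[OF xP]
      by (simp add: A.m_comm[of "lam u" "lam x"] A.m_assoc)
    finally show ?thesis using u m_inv_consistent[OF PG(2) u(1)] by simp
  qed
  then obtain V where V: "V \<in> hom G A" "\<And>x. x \<in> P \<Longrightarrow> V x = lam x [^]\<^bsub>A\<^esub> card (rcosets P)"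
    using exists_transfer[OF fin PG(2) A.comm_group_axioms lam] by blast
  interpret V: group_hom G A V by unfold_locales (rule V(1))
  define N where "N = kernel G A V"
  have "N \<lhd> G" unfolding N_def by (rule V.normal_kernel)
  moreover have "g [^] p \<in> N" if "g \<in> carrier G" for g
    using that A.pow_order_eq_1[of "V g"] ordA V.hom_nat_pow[of g p] by (simp add: N_def kernel_def)
  moreover have "N \<noteq> carrier G"
  proof
    assume N: "N = carrier G"
    have "card M < card P" using M(2) n prime_gt_1_nat[OF p] by simp
    then have "M \<noteq> P" by blast
    then obtain x where x: "x \<in> P" "x \<notin> M" using M.subset by auto
    have lx: "lam x \<in> carrier A" using x lam.hom_closed by simp
    have "V x = \<one>\<^bsub>A\<^esub>" using N PG.mem_carrier[OF x(1)] unfolding N_def kernel_def by blast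
    \<comment> \<open>The order of \<open>lam x\<close> divides both \<open>p\<close> and the index of \<open>P\<close>.\<close>
    then have "A.ord (lam x) dvd card (rcosets P)" using V(2)[OF x(1)] lx A.pow_eq_id by simp
    moreover have "A.ord (lam x) dvd p" using A.ord_dvd_group_order[OF lx] ordA by simp
    ultimately have "A.ord (lam x) = 1" using PG(3) p by (auto simp: prime_nat_iff)
    then have "lam x = \<one>\<^bsub>A\<^esub>" using A.ord_eq_1[OF lx] by simp
    then have "M #>\<^bsub>?P\<^esub> x = M" by (simp add: lam_def A_def)
    then show False using P.rcos_self[of x M] x M.is_subgroup by simp
  qed
  ultimately show thesis using that by blast
qed

end

section \<open>Characteristically simple groups with \<open>p\<close>-supersolvable proper subgroups\<close>

definition characteristically_simple :: "('a, 'b) monoid_scheme \<Rightarrow> bool"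
  where "characteristically_simple G \<longleftrightarrow>
    (\<forall>A. subgroup A G \<and> (\<forall>\<alpha> \<in> iso G G. \<alpha> ` A \<subseteq> A) \<longrightarrow> A = {\<one>\<^bsub>G\<^esub>} \<or> A = carrier G)"

text \<open>The intersection of all images of \<open>A\<close> under automorphisms, written with preimages.\<close>

definition characteristic_core :: "('a, 'b) monoid_scheme \<Rightarrow> 'a set \<Rightarrow> 'a set"
  where "characteristic_core G A = {x \<in> carrier G. \<forall>\<alpha> \<in> iso G G. \<alpha> x \<in> A}"

context group
begin

lemma iso_self_group_hom: "\<alpha> \<in> iso G G \<Longrightarrow> group_hom G G \<alpha>"
  by (simp add: group_hom_def group_hom_axioms_def is_group iso_imp_homomorphism)

lemma subgroup_characteristic_core:
  assumes "subgroup A G"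
  shows "subgroup (characteristic_core G A) G"
proof (rule subgroupI)
  show "characteristic_core G A \<noteq> {}"
  proof -
    have "\<alpha> \<one> \<in> A" if "\<alpha> \<in> iso G G" for \<alpha>
      using group_hom.hom_one[OF iso_self_group_hom[OF that]] subgroup.one_closed[OF assms] by simp
    then show ?thesis unfolding characteristic_core_def by blast
  qed
  fix a b assume a: "a \<in> characteristic_core G A" and b: "b \<in> characteristic_core G A"
  have G: "a \<in> carrier G" "b \<in> carrier G" using a b by (auto simp: characteristic_core_def)
  have "\<alpha> (inv a) \<in> A" "\<alpha> (a \<otimes> b) \<in> A" if \<alpha>: "\<alpha> \<in> iso G G" for \<alpha>
  proof -
    interpret group_hom G G \<alpha> by (rule iso_self_group_hom[OF \<alpha>])
    have "\<alpha> a \<in> A" "\<alpha> b \<in> A" using a b \<alpha> by (auto simp: characteristic_core_def)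
    then show "\<alpha> (inv a) \<in> A" "\<alpha> (a \<otimes> b) \<in> A"
      using G subgroup.m_closed[OF assms] subgroup.m_inv_closed[OF assms] by simp_all
  qed
  then show "inv a \<in> characteristic_core G A" "a \<otimes> b \<in> characteristic_core G A"
    using G by (simp_all add: characteristic_core_def)
qed (auto simp: characteristic_core_def)

lemma characteristic_core_subset: "characteristic_core G A \<subseteq> A"
  using iso_set_refl[of G] by (auto simp: characteristic_core_def)

lemma characteristic_core_cases:
  assumes "characteristically_simple G" "subgroup A G"
  shows "characteristic_core G A = {\<one>} \<or> characteristic_core G A = carrier G"
proof -
  have "\<beta> ` characteristic_core G A \<subseteq> characteristic_core G A" if \<beta>: "\<beta> \<in> iso G G" for \<beta>
  proof
    fix y assume "y \<in> \<beta> ` characteristic_core G A"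
    then obtain x where x: "x \<in> characteristic_core G A" "y = \<beta> x" by blast
    have "\<alpha> (\<beta> x) \<in> A" if "\<alpha> \<in> iso G G" for \<alpha>
    proof -
      have "\<alpha> \<circ> \<beta> \<in> iso G G" using iso_set_trans[OF \<beta> that] by (simp add: comp_def)
      then have "(\<alpha> \<circ> \<beta>) x \<in> A" using x(1) unfolding characteristic_core_def by blast
      then show ?thesis by simp
    qed
    moreover have "\<beta> x \<in> carrier G"
      using x(1) group_hom.hom_closed[OF iso_self_group_hom[OF \<beta>]] by (simp add: characteristic_core_def)
    ultimately show "y \<in> characteristic_core G A" using x(2) by (simp add: characteristic_core_def)
  qed
  then show ?thesis
    using assms subgroup_characteristic_core[OF assms(2)] unfolding characteristically_simple_def by blast
qed

lemma normal_p_subgroup_le_sylow_subgroup: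
  assumes "finite (carrier G)" "prime p" "D \<lhd> G" "card D = p ^ n" "sylow_subgroup p G P"
  shows "D \<subseteq> P"
proof -
  have D: "subgroup D G" using assms normal_imp_subgroup by blast
  obtain g where g: "g \<in> carrier G" "conjugate_set G g D \<subseteq> P"
    using p_subgroup_conj_into[OF assms(1,2) D assms(4)] sylow_subgroupD[OF assms(5)] by metis
  then show ?thesis
    using normal_iff_normalizer[OF D] assms(3) mem_normalizer_iff[OF subgroup.subset[OF D]] by auto
qed

text \<open>Otherwise the core of a Sylow \<open>p\<close>-subgroup \<open>P\<close> is trivial and there is no nontrivial normal
\<open>p\<close>-subgroup. So the normalizers of nontrivial \<open>p\<close>-subgroups are proper, hence \<open>p\<close>-supersolvable,
which gives control of fusion and, by transfer, a proper normal subgroup \<open>N\<close> that contains all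
\<open>p\<close>-th powers. Its core is trivial too, although it contains every element of order prime to
\<open>p\<close>.\<close>

theorem p_group_if_proper_subgroups_p_supersolvable:
  assumes fin: "finite (carrier G)" and p: "prime p" "p dvd order G"
    and least: "\<And>q. prime q \<Longrightarrow> q dvd order G \<Longrightarrow> p \<le> q"
    and simple: "characteristically_simple G"
    and proper: "\<And>T. subgroup T G \<Longrightarrow> T \<noteq> carrier G \<Longrightarrow> p_supersolvable p (G\<lparr>carrier := T\<rparr>)"
  shows "is_p_group p G"
proof (rule ccontr)
  assume not_p: "\<not> is_p_group p G"
  obtain P where P: "sylow_subgroup p G P" using sylow_subgroup_exists[OF fin p(1)] .
  note PG = sylow_subgroupD[OF P]
  have P_ne: "P \<noteq> carrier G" using not_p PG(4) by (auto simp: is_p_group_def order_def)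
  have P_ne_one: "P \<noteq> {\<one>}" using PG(1,3) p(2) by auto
  have no_normal: "D = {\<one>}" if D: "D \<lhd> G" "card D = p ^ n" for D n
  proof -
    have DG: "D \<subseteq> carrier G" using D(1) normal_imp_subgroup subgroup.subset by blast
    have "\<alpha> ` D \<subseteq> P" if \<alpha>: "\<alpha> \<in> iso G G" for \<alpha>
    proof (rule normal_p_subgroup_le_sylow_subgroup[OF fin p(1) _ _ P])
      show "\<alpha> ` D \<lhd> G" using iso_normal_subgroup[OF \<alpha> is_group is_group D(1)] .
      have "inj_on \<alpha> D" using \<alpha> DG by (auto simp: iso_def bij_betw_def intro: inj_on_subset)
      then show "card (\<alpha> ` D) = p ^ n" using D(2) by (simp add: card_image)
    qed
    then have "D \<subseteq> characteristic_core G P" using DG by (auto simp: characteristic_core_def)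
    moreover have "characteristic_core G P \<noteq> carrier G"
      using characteristic_core_subset[of P] P_ne subgroup.subset[OF PG(2)] by blast
    ultimately have "D \<subseteq> {\<one>}" using characteristic_core_cases[OF simple PG(2)] by simp
    then show ?thesis using subgroup.one_closed[OF normal_imp_subgroup[OF D(1)]] by blast
  qed
  have factor: "normalizers_factorize p G"
    unfolding normalizers_factorize_def
  proof (intro allI impI)
    fix D n S
    assume D: "subgroup D G" "card D = p ^ n" "D \<noteq> {\<one>}"
      and S: "sylow_subgroup p (G\<lparr>carrier := normalizer G D\<rparr>) S"
    let ?N = "G\<lparr>carrier := normalizer G D\<rparr>"
    have N: "subgroup (normalizer G D) G" using normalizer_imp_subgroup subgroup.subset[OF D(1)] by blast
    interpret N: group ?N using N subgroup_imp_group by blast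
    have "normalizer G D \<noteq> carrier G" using no_normal normal_iff_normalizer[OF D(1)] D by blast
    then have "p_supersolvable p ?N" using proper N by blast
    moreover have "card (normalizer G D) dvd order G" using lagrange[OF N] by (metis dvd_triv_right)
    then have "p \<le> q" if "prime q" "q dvd order ?N" for q
      using least[OF that(1)] that(2) dvd_trans by (auto simp: order_def)
    ultimately have "centralizer ?N D <#>\<^bsub>?N\<^esub> S = carrier ?N"
      using N.p_supersolvable_factorization[OF _ p(1) _ subgroup_in_normalizer[OF D(1)] D(2) S] by blast
    moreover have "centralizer ?N D \<subseteq> centralizer G D"
      using subgroup.subset[OF N] by (auto simp: centralizer_def)
    ultimately have "x \<in> centralizer G D <#> S" if x: "x \<in> normalizer G D" for x
    proof -
      assume eq: "centralizer ?N D <#>\<^bsub>?N\<^esub> S = carrier ?N" and sub: "centralizer ?N D \<subseteq> centralizer G D"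
      obtain c s where "c \<in> centralizer ?N D" "s \<in> S" "x = c \<otimes> s"
      proof -
        have "x \<in> centralizer ?N D <#>\<^bsub>?N\<^esub> S" using x eq by simp
        then show ?thesis using that by (auto simp: set_mult_def)
      qed
      then show ?thesis using sub unfolding set_mult_def by blast
    qed
    then show "normalizer G D \<subseteq> centralizer G D <#> S" by blast
  qed
  have fusion: "\<exists>u \<in> P. u \<otimes> x \<otimes> inv u = g \<otimes> x \<otimes> inv g"
    if "g \<in> carrier G" "x \<in> P" "g \<otimes> x \<otimes> inv g \<in> P" for g x
    using sylow_subgroup_controls_fusion[OF fin p(1) factor P that(2,1,3)] .
  obtain N where N: "N \<lhd> G" "N \<noteq> carrier G" "\<And>g. g \<in> carrier G \<Longrightarrow> g [^] p \<in> N"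
    using exists_normal_if_fusion_controlled[OF fin p(1) P P_ne_one fusion] by blast
  have NG: "subgroup N G" using N(1) normal_imp_subgroup by blast
  have "characteristic_core G N \<noteq> carrier G"
    using characteristic_core_subset[of N] N(2) subgroup.subset[OF NG] by blast
  then have core: "characteristic_core G N = {\<one>}" using characteristic_core_cases[OF simple NG] by blast
  have "P = carrier G"
  proof (rule eq_carrier_if_sylow_subgroups[OF fin PG(2)])
    fix r :: nat assume r: "prime r"
    show "\<exists>R. sylow_subgroup r G R \<and> R \<subseteq> P"
    proof (cases "r = p")
      case True
      then show ?thesis using P by blast
    next
      case False
      obtain R where R: "sylow_subgroup r G R" using sylow_subgroup_exists[OF fin r] .
      note RG = sylow_subgroupD[OF R]
      interpret R: group "G\<lparr>carrier := R\<rparr>" using RG subgroup_imp_group by blast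
      obtain j where j: "card R = r ^ j" using RG by blast
      have "coprime p (r ^ j)" using False r p(1) by (simp add: primes_coprime)
      \<comment> \<open>So every element of \<open>R\<close> is a \<open>p\<close>-th power, and this property is invariant under automorphisms.\<close>
      then obtain k m where km: "p * k = r ^ j * m + 1"
        using bezout_nat[of p "r ^ j"] prime_gt_0_nat[OF p(1)] by auto
      have "y \<in> characteristic_core G N" if y: "y \<in> R" for y
      proof -
        have yG: "y \<in> carrier G" using subgroup.mem_carrier[OF RG(2) y] .
        have "y [^]\<^bsub>G\<lparr>carrier := R\<rparr>\<^esub> (r ^ j) = \<one>"
          using R.pow_order_eq_1[of y] y j by (simp add: order_def)
        then have "y [^] (r ^ j) = \<one>" using nat_pow_consistent[of y "r ^ j" R] by simp
        then have "y = y [^] (r ^ j * m + 1)" using yG nat_pow_pow[OF yG, of "r ^ j" m] nat_pow_mult[OF yG, of "r ^ j * m" 1] by simp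
        also have "\<dots> = (y [^] k) [^] p" using nat_pow_pow[OF yG, of k p] km by (simp add: mult.commute)
        finally have y_eq: "y = (y [^] k) [^] p" .
        have "\<alpha> y \<in> N" if \<alpha>: "\<alpha> \<in> iso G G" for \<alpha>
        proof -
          interpret \<alpha>: group_hom G G \<alpha> using iso_self_group_hom[OF \<alpha>] .
          have "\<alpha> y = \<alpha> (y [^] k) [^] p" using y_eq \<alpha>.hom_nat_pow[of "y [^] k" p] yG by simp
          then show ?thesis using N(3)[of "\<alpha> (y [^] k)"] yG by simp
        qed
        then show ?thesis using yG by (simp add: characteristic_core_def)
      qed
      then have "R \<subseteq> P" using core subgroup.one_closed[OF PG(2)] by auto
      then show ?thesis using R by blast
    qed
  qed
  then show False using P_ne by blast
qed

end

section \<open>Chief factors under surjective homomorphisms\<close>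

text \<open>For finite \<open>G\<close> and normal \<open>N\<close> this says that \<open>G Mod N\<close> is \<open>p\<close>-supersolvable, in terms of chief factors of \<open>G\<close> itself. In
this form it is monotone in \<open>N\<close>, and different normal subgroups can be compared without passing
between quotient groups.\<close>

definition p_supersolvable_above :: "nat \<Rightarrow> ('a, 'b) monoid_scheme \<Rightarrow> 'a set \<Rightarrow> bool"
  where "p_supersolvable_above p G N \<longleftrightarrow> (\<forall>K L. chief_factor G K L \<longrightarrow> N \<subseteq> L \<longrightarrow>
    order (chief_quotient G K L) = p \<or> is_p'_group p (chief_quotient G K L))"

context group_hom
begin

lemma card_image_mult_card_kernel:
  assumes "finite (carrier G)" "subgroup K G" "kernel G H h \<subseteq> K"
  shows "card (h ` K) * card (kernel G H h) = card K"
proof -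
  interpret K: group_hom "G\<lparr>carrier := K\<rparr>" "H\<lparr>carrier := h ` K\<rparr>" h
    by (rule induced_group_hom[OF assms(2)])
  have ker: "kernel (G\<lparr>carrier := K\<rparr>) (H\<lparr>carrier := h ` K\<rparr>) h = kernel G H h"
    using assms(2,3) subgroup.subset by (auto simp: kernel_def)
  have "card (carrier (G\<lparr>carrier := K\<rparr> Mod kernel G H h)) = card (h ` K)"
    using iso_same_card[OF K.FactGroup_iso] ker by simp
  then show ?thesis
    using K.G.lagrange[OF K.subgroup_kernel] ker by (simp add: FactGroup_def order_def)
qed

lemma order_chief_quotient_image:
  assumes "finite (carrier G)" "h ` carrier G = carrier H" "K \<lhd> G" "L \<lhd> G" "L \<subseteq> K" "kernel G H h \<subseteq> L"
  shows "order (chief_quotient H (h ` K) (h ` L)) = order (chief_quotient G K L)"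
proof -
  have sub: "subgroup K G" "subgroup L G" using assms normal_imp_subgroup by blast+
  have norm: "h ` K \<lhd> H" "h ` L \<lhd> H"
    using assms normal.surj_hom_normal_subgroup group_hom_axioms by blast+
  have "card L \<noteq> 0"
    using sub(2) assms(1) subgroup.one_closed subgroup.subset finite_subset card_0_eq by (metis empty_iff)
  have "order (chief_quotient H (h ` K) (h ` L)) * (card (h ` L) * card (kernel G H h)) =
      card (h ` K) * card (kernel G H h)"
    using H.order_chief_quotient[OF norm] assms by (simp add: image_mono flip: mult.assoc)
  then have "order (chief_quotient H (h ` K) (h ` L)) * card L = card K"
    using card_image_mult_card_kernel[OF assms(1) sub(1)] card_image_mult_card_kernel[OF assms(1) sub(2)]
      assms by simp
  then show ?thesis
    using G.order_chief_quotient[OF assms(3-5)] \<open>card L \<noteq> 0\<close> by (metis mult_right_cancel)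
qed

lemma normal_preimage:
  assumes "M \<lhd> H"
  shows "{g \<in> carrier G. h g \<in> M} \<lhd> G"
proof (rule G.normal_invI)
  interpret M: normal M H by fact
  show "subgroup {g \<in> carrier G. h g \<in> M} G"
    by (rule G.subgroupI) auto
qed (use normal.inv_op_closed2[OF assms] in auto)

lemma image_preimage:
  assumes "h ` carrier G = carrier H" "M \<subseteq> carrier H"
  shows "h ` {g \<in> carrier G. h g \<in> M} = M"
  using assms by (auto simp: image_iff set_eq_iff subset_iff) metis

lemma preimage_image:
  assumes "subgroup K G" "kernel G H h \<subseteq> K"
  shows "{g \<in> carrier G. h g \<in> h ` K} = K"
proof
  show "K \<subseteq> {g \<in> carrier G. h g \<in> h ` K}" using subgroup.subset[OF assms(1)] by blast
  show "{g \<in> carrier G. h g \<in> h ` K} \<subseteq> K"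
  proof
    fix g assume "g \<in> {g \<in> carrier G. h g \<in> h ` K}"
    then obtain k where k: "g \<in> carrier G" "k \<in> K" "h g = h k" by auto
    then have kG: "k \<in> carrier G" using assms subgroup.mem_carrier by metis
    then have "g \<otimes> inv k \<in> kernel G H h" using k by (simp add: kernel_def)
    then have "g \<otimes> inv k \<otimes> k \<in> K" using assms k subgroup.m_closed by (metis subsetD)
    then show "g \<in> K" using k kG by (simp add: G.m_assoc)
  qed
qed

text \<open>Images and preimages are mutually inverse between the normal subgroups above the kernel and those of
\<open>H\<close>.\<close>

lemma chief_factor_image:
  assumes "h ` carrier G = carrier H" "chief_factor G K L" "kernel G H h \<subseteq> L"
  shows "chief_factor H (h ` K) (h ` L)"
proof -
  have KL: "K \<lhd> G" "L \<lhd> G" "L \<subset> K" and min: "\<And>M. M \<lhd> G \<Longrightarrow> L \<subset> M \<Longrightarrow> M \<subset> K \<Longrightarrow> False"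
    using assms(2) by (auto simp: chief_factor_def)
  have norm: "h ` K \<lhd> H" "h ` L \<lhd> H"
    using KL assms(1) normal.surj_hom_normal_subgroup group_hom_axioms by blast+
  have preK: "{g \<in> carrier G. h g \<in> h ` K} = K" and preL: "{g \<in> carrier G. h g \<in> h ` L} = L"
    using preimage_image assms(3) KL normal_imp_subgroup by blast+
  have False if M: "M \<lhd> H" "h ` L \<subset> M" "M \<subset> h ` K" for M
  proof (rule min[OF normal_preimage[OF M(1)]])
    have im: "h ` {g \<in> carrier G. h g \<in> M} = M"
      using image_preimage[OF assms(1)] subgroup.subset[OF normal_imp_subgroup[OF M(1)]] .
    show "L \<subset> {g \<in> carrier G. h g \<in> M}" using M(2) preL im by blast
    show "{g \<in> carrier G. h g \<in> M} \<subset> K" using M(3) preK im by blast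
  qed
  moreover have "h ` L \<subseteq> h ` K" "h ` L \<noteq> h ` K" using KL(3) preK preL by auto
  ultimately show ?thesis using norm unfolding chief_factor_def by blast
qed

lemma chief_factor_preimage:
  assumes surj: "h ` carrier G = carrier H" and "chief_factor H K L"
  shows "chief_factor G {g \<in> carrier G. h g \<in> K} {g \<in> carrier G. h g \<in> L}"
proof -
  have KL: "K \<lhd> H" "L \<lhd> H" "L \<subset> K" and min: "\<And>M. M \<lhd> H \<Longrightarrow> L \<subset> M \<Longrightarrow> M \<subset> K \<Longrightarrow> False"
    using assms(2) by (auto simp: chief_factor_def)
  have sub: "K \<subseteq> carrier H" "L \<subseteq> carrier H" "subgroup L H"
    using KL normal_imp_subgroup subgroup.subset by blast+
  let ?K = "{g \<in> carrier G. h g \<in> K}" and ?L = "{g \<in> carrier G. h g \<in> L}"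
  have im: "h ` ?K = K" "h ` ?L = L" using image_preimage[OF surj] sub by blast+
  have ker: "kernel G H h \<subseteq> ?L" using subgroup.one_closed[OF sub(3)] by (auto simp: kernel_def)
  have False if M: "M \<lhd> G" "?L \<subset> M" "M \<subset> ?K" for M
  proof (rule min)
    show "h ` M \<lhd> H" using M surj normal.surj_hom_normal_subgroup group_hom_axioms by blast
    have pre: "{g \<in> carrier G. h g \<in> h ` M} = M"
      using preimage_image[OF normal_imp_subgroup[OF M(1)]] ker M(2) by blast
    have "h ` M \<noteq> L" "h ` M \<noteq> K" using pre M(2,3) by auto
    moreover have "L \<subseteq> h ` M" using image_mono[of ?L M h] M(2) im(2) by simp
    moreover have "h ` M \<subseteq> K" using image_mono[of M ?K h] M(3) im(1) by simp
    ultimately show "L \<subset> h ` M" "h ` M \<subset> K" by auto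
  qed
  moreover have "?L \<subset> ?K"
  proof -
    have "?L \<subseteq> ?K" using KL(3) by blast
    moreover have "L = K" if "?L = ?K" using arg_cong[OF that, of "image h"] unfolding im .
    ultimately show ?thesis using KL(3) by (intro psubsetI) auto
  qed
  ultimately show ?thesis
    using normal_preimage[OF KL(1)] normal_preimage[OF KL(2)] unfolding chief_factor_def by blast
qed

lemma p_supersolvable_above_kernel:
  assumes fin: "finite (carrier G)" and surj: "h ` carrier G = carrier H" and "p_supersolvable p H"
  shows "p_supersolvable_above p G (kernel G H h)"
  unfolding p_supersolvable_above_def
proof (intro allI impI)
  fix K L assume KL: "chief_factor G K L" "kernel G H h \<subseteq> L"
  then have "order (chief_quotient H (h ` K) (h ` L)) = order (chief_quotient G K L)"
    using order_chief_quotient_image[OF fin surj] by (auto simp: chief_factor_def)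
  then show "order (chief_quotient G K L) = p \<or> is_p'_group p (chief_quotient G K L)"
    using chief_factor_image[OF surj KL] assms(3) unfolding p_supersolvable_def is_p'_group_def by metis
qed

lemma p_supersolvable_image:
  assumes fin: "finite (carrier G)" and surj: "h ` carrier G = carrier H"
    and "p_supersolvable_above p G N" "N \<subseteq> kernel G H h"
  shows "p_supersolvable p H"
  unfolding p_supersolvable_def
proof (intro conjI allI impI)
  show "group H" by (rule H.is_group)
  show "finite (carrier H)" using fin surj by (metis finite_imageI)
  fix K L assume KL: "chief_factor H K L"
  have KLn: "K \<lhd> H" "L \<lhd> H" "L \<subseteq> K" using KL by (auto simp: chief_factor_def)
  have sub: "K \<subseteq> carrier H" "L \<subseteq> carrier H" "subgroup L H"
    using subgroup.subset[OF normal_imp_subgroup[OF KLn(1)]]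
      subgroup.subset[OF normal_imp_subgroup[OF KLn(2)]] normal_imp_subgroup[OF KLn(2)] .
  let ?K = "{g \<in> carrier G. h g \<in> K}" and ?L = "{g \<in> carrier G. h g \<in> L}"
  have im: "h ` ?K = K" "h ` ?L = L" using image_preimage[OF surj] sub by blast+
  have ker: "kernel G H h \<subseteq> ?L" using subgroup.one_closed[OF sub(3)] by (auto simp: kernel_def)
  note chief = chief_factor_preimage[OF surj KL]
  then have "order (chief_quotient H (h ` ?K) (h ` ?L)) = order (chief_quotient G ?K ?L)"
    using order_chief_quotient_image[OF fin surj _ _ _ ker] by (auto simp: chief_factor_def)
  then have eq: "order (chief_quotient H K L) = order (chief_quotient G ?K ?L)"
    unfolding im .
  have "N \<subseteq> ?L" using assms(4) ker by blast
  then have "order (chief_quotient G ?K ?L) = p \<or> is_p'_group p (chief_quotient G ?K ?L)"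
    using chief assms(3) unfolding p_supersolvable_above_def by blast
  then show "order (chief_quotient H K L) = p \<or> is_p'_group p (chief_quotient H K L)"
    unfolding is_p'_group_def eq .
qed

end

context group
begin

section \<open>The \<open>p\<close>-supersolvable residual\<close>

lemma set_mult_subset_subgroup:
  assumes "subgroup M G" "A \<subseteq> M" "B \<subseteq> M"
  shows "A <#> B \<subseteq> M"
  using assms(2,3) subgroup.m_closed[OF assms(1)] by (auto simp: set_mult_def)

lemma subset_set_mult:
  assumes "subgroup A G" "subgroup B G"
  shows "A \<subseteq> A <#> B" "B \<subseteq> A <#> B"
proof -
  have "a \<in> A <#> B" if "a \<in> A" for a
  proof -
    have "a = a \<otimes> \<one>" using that subgroup.mem_carrier[OF assms(1)] by simp
    then show ?thesis using that subgroup.one_closed[OF assms(2)] unfolding set_mult_def by blast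
  qed
  moreover have "b \<in> A <#> B" if "b \<in> B" for b
  proof -
    have "b = \<one> \<otimes> b" using that subgroup.mem_carrier[OF assms(2)] by simp
    then show ?thesis using that subgroup.one_closed[OF assms(1)] unfolding set_mult_def by blast
  qed
  ultimately show "A \<subseteq> A <#> B" "B \<subseteq> A <#> B" by blast+
qed

lemma left_factor_mem:
  assumes "subgroup M G" "n \<in> carrier G" "k \<in> M" "n \<otimes> k \<in> M"
  shows "n \<in> M"
proof -
  have k: "k \<in> carrier G" using subgroup.mem_carrier[OF assms(1,3)] .
  have "n \<otimes> k \<otimes> inv k \<in> M"
    using subgroup.m_closed[OF assms(1,4) subgroup.m_inv_closed[OF assms(1,3)]] .
  then show ?thesis using k assms(2) by (simp add: m_assoc)
qed

lemma right_factor_mem: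
  assumes "subgroup M G" "n \<in> M" "k \<in> carrier G" "n \<otimes> k \<in> M"
  shows "k \<in> M"
proof -
  have n: "n \<in> carrier G" using subgroup.mem_carrier[OF assms(1,2)] .
  have "inv n \<otimes> (n \<otimes> k) \<in> M"
    using subgroup.m_closed[OF assms(1) subgroup.m_inv_closed[OF assms(1,2)] assms(4)] .
  then show ?thesis using n assms(3) by (simp add: m_assoc[symmetric])
qed

lemma card_subgroup_pos:
  assumes "finite (carrier G)" "subgroup A G"
  shows "card A > 0"
  using assms finite_subset[OF subgroup.subset[OF assms(2)]] subgroup.one_closed[OF assms(2)]
  by (auto simp: card_gt_0_iff)

text \<open>With the next lemma this is the isomorphism theorem for a chief factor \<open>K / L\<close> and a normal subgroup
\<open>N\<close>: the factor reappears above \<open>N\<close> if \<open>N \<inter> K \<subseteq> L\<close>, and below \<open>N\<close> otherwise. Orders suffice, as the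
properties in question depend only on them.\<close>

lemma chief_factor_set_mult:
  assumes fin: "finite (carrier G)" and chief: "chief_factor G K L" and N: "N \<lhd> G"
    and le: "N \<inter> K \<subseteq> L"
  shows "chief_factor G (N <#> K) (N <#> L)"
    and "order (chief_quotient G (N <#> K) (N <#> L)) = order (chief_quotient G K L)"
proof -
  have KL: "K \<lhd> G" "L \<lhd> G" "L \<subset> K" and min: "\<And>M. M \<lhd> G \<Longrightarrow> L \<subset> M \<Longrightarrow> M \<subset> K \<Longrightarrow> False"
    using chief by (auto simp: chief_factor_def)
  note sub = normal_imp_subgroup[OF KL(1)] normal_imp_subgroup[OF KL(2)] normal_imp_subgroup[OF N]
  have norm: "N <#> K \<lhd> G" "N <#> L \<lhd> G"
    using normal_subgroup_set_mult_closed[OF N] KL by auto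
  note sub' = normal_imp_subgroup[OF norm(1)] normal_imp_subgroup[OF norm(2)]
  have sub_le: "N <#> L \<subseteq> N <#> K" using KL(3) by (auto simp: set_mult_def)
  have "\<exists>k. k \<in> K \<and> k \<notin> N <#> L"
  proof -
    obtain k where k: "k \<in> K" "k \<notin> L" using KL(3) by blast
    have "k \<notin> N <#> L"
    proof
      assume "k \<in> N <#> L"
      then obtain n l where nl: "n \<in> N" "l \<in> L" "k = n \<otimes> l" by (auto simp: set_mult_def)
      have "n \<in> K"
        using left_factor_mem[OF sub(1), of n l] nl k(1) KL(3) subgroup.mem_carrier[OF sub(3)] by auto
      then have "n \<in> L" using le nl by blast
      then show False using k(2) nl subgroup.m_closed[OF sub(2)] by blast
    qed
    then show ?thesis using k by blast
  qed
  then have strict: "N <#> L \<subset> N <#> K" using sub_le subset_set_mult(2)[OF sub(3,1)] by blast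
  have False if M: "M \<lhd> G" "N <#> L \<subset> M" "M \<subset> N <#> K" for M
  proof -
    note Msub = normal_imp_subgroup[OF M(1)]
    have NM: "N \<subseteq> M" "L \<subseteq> M"
      using M(2) subset_set_mult(1)[OF sub(3,2)] subset_set_mult(2)[OF sub(3,2)] by blast+
    have MK: "M \<inter> K \<lhd> G" using normal_subgroup_intersect[OF M(1) KL(1)] .
    consider "M \<inter> K = L" | "M \<inter> K = K" using min[OF MK] NM(2) KL(3) by blast
    then show False
    proof cases
      case 1
      have "M \<subseteq> N <#> L"
      proof
        fix m assume m: "m \<in> M"
        then have "m \<in> N <#> K" using M(3) by blast
        then obtain n k where nk: "n \<in> N" "k \<in> K" "m = n \<otimes> k" by (auto simp: set_mult_def)
        then have "k \<in> M"
          using right_factor_mem[OF Msub, of n k] NM m subgroup.mem_carrier[OF sub(1)] by auto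
        then have "k \<in> L" using 1 nk by blast
        then show "m \<in> N <#> L" using nk unfolding set_mult_def by blast
      qed
      then show False using M(2) by blast
    next
      case 2
      then have "N <#> K \<subseteq> M" using set_mult_subset_subgroup[OF Msub NM(1)] by blast
      then show False using M(3) by blast
    qed
  qed
  then show "chief_factor G (N <#> K) (N <#> L)"
    unfolding chief_factor_def using norm strict by blast
  have int: "N \<inter> K = N \<inter> L" using le KL(3) by blast
  define q q' c where "q = order (chief_quotient G K L)"
    and "q' = order (chief_quotient G (N <#> K) (N <#> L))" and "c = card (N \<inter> L)"
  have "q' * card (N <#> L) * c = card N * card K"
    using order_chief_quotient[OF norm sub_le] card_normal_set_mult[OF N sub(1)] int
    by (simp add: q'_def c_def)
  also have "\<dots> = q * (card N * card L)"
    using order_chief_quotient[OF KL(1,2)] KL(3) by (simp add: q_def flip: mult.assoc)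
  also have "\<dots> = q * card (N <#> L) * c"
    using card_normal_set_mult[OF N sub(2)] by (simp add: c_def)
  finally have "q' * (card (N <#> L) * c) = q * (card (N <#> L) * c)" by (simp add: mult.assoc)
  moreover have "card (N <#> L) > 0" using card_subgroup_pos[OF fin sub'(2)] .
  moreover have "c > 0" using card_subgroup_pos[OF fin subgroups_Inter_pair[OF sub(3,2)]] by (simp add: c_def)
  ultimately have "q' = q" by simp
  then show "order (chief_quotient G (N <#> K) (N <#> L)) = order (chief_quotient G K L)"
    by (simp add: q_def q'_def)
qed

text \<open>Here \<open>(N \<inter> K) <#> L = K\<close>, since the left side is normal and lies properly above \<open>L\<close>; the same
argument applies to each normal subgroup of \<open>K\<close> that is not contained in \<open>L\<close>.\<close>

lemma chief_factor_Int:
  assumes fin: "finite (carrier G)" and chief: "chief_factor G K L" and N: "N \<lhd> G"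
    and not_le: "\<not> N \<inter> K \<subseteq> L"
  shows "chief_factor G (N \<inter> K) (N \<inter> L)"
    and "order (chief_quotient G (N \<inter> K) (N \<inter> L)) = order (chief_quotient G K L)"
proof -
  have KL: "K \<lhd> G" "L \<lhd> G" "L \<subset> K" and min: "\<And>M. M \<lhd> G \<Longrightarrow> L \<subset> M \<Longrightarrow> M \<subset> K \<Longrightarrow> False"
    using chief by (auto simp: chief_factor_def)
  note sub = normal_imp_subgroup[OF KL(1)] normal_imp_subgroup[OF KL(2)] normal_imp_subgroup[OF N]
  have norm: "N \<inter> K \<lhd> G" "N \<inter> L \<lhd> G" using normal_subgroup_intersect[OF N] KL by auto
  note sub' = normal_imp_subgroup[OF norm(1)] normal_imp_subgroup[OF norm(2)]
  have mult_eq: "M <#> L = K" if M: "M \<lhd> G" "M \<subseteq> K" "\<not> M \<subseteq> L" for M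
  proof -
    note Msub = normal_imp_subgroup[OF M(1)]
    have "M <#> L \<subseteq> K" using set_mult_subset_subgroup[OF sub(1) M(2)] KL(3) by blast
    moreover have "L \<subset> M <#> L"
      using subset_set_mult[OF Msub sub(2)] M(3) by blast
    ultimately show ?thesis using min[OF normal_subgroup_set_mult_closed[OF M(1) KL(2)]] by blast
  qed
  have False if M: "M \<lhd> G" "N \<inter> L \<subset> M" "M \<subset> N \<inter> K" for M
  proof -
    note Msub = normal_imp_subgroup[OF M(1)]
    have "\<not> M \<subseteq> L" using M by blast
    then have eq: "M <#> L = K" using mult_eq[OF M(1)] M(3) by blast
    have "N \<inter> K \<subseteq> M"
    proof
      fix x assume x: "x \<in> N \<inter> K"
      then obtain m l where ml: "m \<in> M" "l \<in> L" "x = m \<otimes> l" using eq by (auto simp: set_mult_def)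
      then have "l \<in> N"
        using right_factor_mem[OF sub(3), of m l] M(3) x subgroup.mem_carrier[OF sub(2)] by auto
      then have "l \<in> M" using ml M(2) by blast
      then show "x \<in> M" using ml subgroup.m_closed[OF Msub] by blast
    qed
    then show False using M(3) by blast
  qed
  moreover have "N \<inter> L \<subset> N \<inter> K" using KL(3) not_le by blast
  ultimately show "chief_factor G (N \<inter> K) (N \<inter> L)"
    unfolding chief_factor_def using norm by blast
  define q q' where "q = order (chief_quotient G K L)"
    and "q' = order (chief_quotient G (N \<inter> K) (N \<inter> L))"
  have int: "N \<inter> K \<inter> L = N \<inter> L" using KL(3) by blast
  have "q * card L * card (N \<inter> L) = card K * card (N \<inter> L)"
    using order_chief_quotient[OF KL(1,2)] KL(3) by (simp add: q_def)
  also have "\<dots> = card (N \<inter> K) * card L"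
    using card_normal_set_mult[OF norm(1) sub(2)] mult_eq[OF norm(1)] not_le int by simp
  also have "\<dots> = q' * card (N \<inter> L) * card L"
  proof -
    have "N \<inter> L \<subseteq> N \<inter> K" using KL(3) by blast
    then show ?thesis using order_chief_quotient[OF norm] by (simp add: q'_def)
  qed
  finally have "q * (card L * card (N \<inter> L)) = q' * (card L * card (N \<inter> L))" by (simp add: mult_ac)
  moreover have "card L > 0" "card (N \<inter> L) > 0"
    using card_subgroup_pos[OF fin] sub(2) sub'(2) by auto
  ultimately have "q = q'" by simp
  then show "order (chief_quotient G (N \<inter> K) (N \<inter> L)) = order (chief_quotient G K L)"
    by (simp add: q_def q'_def)
qed

text \<open>This is the closure of the \<open>p\<close>-supersolvable groups under subdirect products. A chief factor above
\<open>N1 \<inter> N2\<close> has the order of one above \<open>N1\<close>, or else it has the order of one below \<open>N1\<close>, which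
reappears above \<open>N2\<close>.\<close>

lemma p_supersolvable_above_Int:
  assumes fin: "finite (carrier G)" and N: "N1 \<lhd> G" "N2 \<lhd> G"
    and above: "p_supersolvable_above p G N1" "p_supersolvable_above p G N2"
  shows "p_supersolvable_above p G (N1 \<inter> N2)"
  unfolding p_supersolvable_above_def is_p'_group_def
proof (intro allI impI)
  fix K L assume chief: "chief_factor G K L" and le: "N1 \<inter> N2 \<subseteq> L"
  have good: "order (chief_quotient G K' L') = p \<or> \<not> p dvd order (chief_quotient G K' L')"
    if "p_supersolvable_above p G N" "N \<lhd> G" "chief_factor G K' L'" "N \<inter> K' \<subseteq> L'" for N K' L'
  proof -
    have "L' \<lhd> G" using that(3) by (simp add: chief_factor_def)
    then have "N \<subseteq> N <#> L'" using subset_set_mult(1) that(2) normal_imp_subgroup by blast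
    then have "order (chief_quotient G (N <#> K') (N <#> L')) = p \<or>
        \<not> p dvd order (chief_quotient G (N <#> K') (N <#> L'))"
      using that(1) chief_factor_set_mult(1)[OF fin that(3,2,4)]
      unfolding p_supersolvable_above_def is_p'_group_def by blast
    then show ?thesis unfolding chief_factor_set_mult(2)[OF fin that(3,2,4)] .
  qed
  show "order (chief_quotient G K L) = p \<or> \<not> p dvd order (chief_quotient G K L)"
  proof (cases "N1 \<inter> K \<subseteq> L")
    case True
    then show ?thesis using good[OF above(1) N(1) chief] by blast
  next
    case False
    have "N2 \<inter> (N1 \<inter> K) \<subseteq> N1 \<inter> L" using le by blast
    then show ?thesis
      using good[OF above(2) N(2) chief_factor_Int(1)[OF fin chief N(1) False]]
      unfolding chief_factor_Int(2)[OF fin chief N(1) False] by blast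
  qed
qed

lemma group_hom_Mod: "N \<lhd> G \<Longrightarrow> group_hom G (G Mod N) (\<lambda>x. N #> x)"
  by (simp add: group_hom_def group_hom_axioms_def is_group normal.factorgroup_is_group
      normal.r_coset_hom_Mod)

lemma kernel_Mod:
  assumes "N \<lhd> G"
  shows "kernel G (G Mod N) (\<lambda>x. N #> x) = N"
proof -
  have N: "subgroup N G" using assms by (rule normal_imp_subgroup)
  have "N #> x = N \<longleftrightarrow> x \<in> N" if "x \<in> carrier G" for x
    using coset_join1[OF _ that N] coset_join2[OF that N] by blast
  then show ?thesis using subgroup.subset[OF N] by (auto simp: kernel_def)
qed

lemma p_supersolvable_above_Mod:
  assumes "finite (carrier G)" "N \<lhd> G" "p_supersolvable p (G Mod N)"
  shows "p_supersolvable_above p G N"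
  using group_hom.p_supersolvable_above_kernel[OF group_hom_Mod[OF assms(2)] assms(1) _ assms(3)]
    kernel_Mod[OF assms(2)] by (simp add: carrier_FactGroup)

lemma p_supersolvable_Mod_carrier:
  assumes "finite (carrier G)"
  shows "p_supersolvable p (G Mod carrier G)"
proof -
  have norm: "carrier G \<lhd> G" using normal_invI[OF subgroup_self] by simp
  interpret Q: group "G Mod carrier G" using normal.factorgroup_is_group[OF norm] .
  have triv: "carrier (G Mod carrier G) = {\<one>\<^bsub>G Mod carrier G\<^esub>}"
    using normal.fact_group_trivial_iff[OF norm assms] by simp
  have False if "chief_factor (G Mod carrier G) K L" for K L
  proof -
    have "K \<subseteq> {\<one>\<^bsub>G Mod carrier G\<^esub>}" "L \<subset> K" "\<one>\<^bsub>G Mod carrier G\<^esub> \<in> L"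
      using that subgroup.subset[OF normal_imp_subgroup, of K "G Mod carrier G"] triv
        subgroup.one_closed[OF normal_imp_subgroup, of L "G Mod carrier G"]
      by (auto simp: chief_factor_def)
    then show False by blast
  qed
  then show ?thesis
    unfolding p_supersolvable_def using Q.is_group triv by auto
qed

text \<open>The residual is a finite intersection of subgroups with \<open>p\<close>-supersolvable quotients. The family is not
empty, as it contains the whole group; otherwise the intersection would be the universal set.\<close>

lemma p_supersolvable_residual_normal_above:
  assumes fin: "finite (carrier G)"
  shows "p_supersolvable_residual p G \<lhd> G"
    and "p_supersolvable_above p G (p_supersolvable_residual p G)"
proof -
  define \<N> where "\<N> = {N. N \<lhd> G \<and> p_supersolvable p (G Mod N)}"
  have "\<N> \<subseteq> Pow (carrier G)"
    using subgroup.subset[OF normal_imp_subgroup] by (auto simp: \<N>_def)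
  then have "finite \<N>" using fin finite_subset by blast
  moreover have "carrier G \<in> \<N>"
    using p_supersolvable_Mod_carrier[OF fin] normal_invI[OF subgroup_self] by (simp add: \<N>_def)
  moreover have "N \<lhd> G \<and> p_supersolvable_above p G N" if "N \<in> \<N>" for N
    using that p_supersolvable_above_Mod[OF fin] by (auto simp: \<N>_def)
  ultimately have "\<Inter>\<N> \<lhd> G \<and> p_supersolvable_above p G (\<Inter>\<N>)"
  proof -
    assume "finite \<N>" "carrier G \<in> \<N>"
      and good: "\<And>N. N \<in> \<N> \<Longrightarrow> N \<lhd> G \<and> p_supersolvable_above p G N"
    have "\<Inter>\<M> \<lhd> G \<and> p_supersolvable_above p G (\<Inter>\<M>)"
      if "finite \<M>" "\<M> \<noteq> {}" "\<M> \<subseteq> \<N>" for \<M>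
      using that
    proof (induction rule: finite_ne_induct)
      case (singleton N)
      then show ?case using good by simp
    next
      case (insert N \<M>)
      then have "N \<lhd> G \<and> p_supersolvable_above p G N" "\<Inter>\<M> \<lhd> G \<and> p_supersolvable_above p G (\<Inter>\<M>)"
        using good by auto
      then show ?case
        using normal_subgroup_intersect p_supersolvable_above_Int[OF fin] by simp
    qed
    then show ?thesis using \<open>finite \<N>\<close> \<open>carrier G \<in> \<N>\<close> by blast
  qed
  then show "p_supersolvable_residual p G \<lhd> G"
    and "p_supersolvable_above p G (p_supersolvable_residual p G)"
    by (simp_all add: p_supersolvable_residual_def \<N>_def)
qed

end

section \<open>Chief factors of groups with normal residuals\<close>

lemma (in group_hom) subgroup_preimage:
  assumes "subgroup A H"
  shows "subgroup {x \<in> carrier G. h x \<in> A} G"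
proof -
  interpret A: subgroup A H by fact
  show ?thesis by (rule G.subgroupI) auto
qed

context group
begin

lemma conjugate_set_r_coset:
  assumes "L \<lhd> G" "g \<in> carrier G" "k \<in> carrier G"
  shows "conjugate_set G g (L #> k) = L #> (g \<otimes> k \<otimes> inv g)"
proof -
  have L: "subgroup L G" "L \<subseteq> carrier G"
    using normal_imp_subgroup[OF assms(1)] subgroup.subset by blast+
  have "conjugate_set G g (L #> k) = (\<lambda>l. g \<otimes> (l \<otimes> k) \<otimes> inv g) ` L"
    by (auto simp: conjugate_set_def r_coset_def)
  also have "\<dots> = (\<lambda>l. g \<otimes> l \<otimes> inv g \<otimes> (g \<otimes> k \<otimes> inv g)) ` L"
  proof (rule image_cong[OF refl])
    fix l assume "l \<in> L"
    then have "l \<in> carrier G" using L by blast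
    then show "g \<otimes> (l \<otimes> k) \<otimes> inv g = g \<otimes> l \<otimes> inv g \<otimes> (g \<otimes> k \<otimes> inv g)"
      using assms by (simp add: m_assoc) (simp add: m_assoc[symmetric])
  qed
  also have "\<dots> = conjugate_set G g L #> (g \<otimes> k \<otimes> inv g)"
    by (auto simp: conjugate_set_def r_coset_def)
  also have "conjugate_set G g L = L"
    using normal_iff_normalizer[OF L(1)] assms mem_normalizer_iff[OF L(2)] by blast
  finally show ?thesis .
qed

lemma carrier_chief_quotient: "carrier (chief_quotient G K L) = (\<lambda>x. L #> x) ` K"
  by (simp add: carrier_FactGroup r_coset_def)

lemma conjugate_set_iso_chief_quotient:
  assumes K: "K \<lhd> G" and L: "L \<lhd> G" and g: "g \<in> carrier G"
  shows "conjugate_set G g \<in> iso (chief_quotient G K L) (chief_quotient G K L)"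
proof (rule isoI)
  have KG: "K \<subseteq> carrier G" using subgroup.subset[OF normal_imp_subgroup[OF K]] .
  have conj: "conjugate_set G x (L #> k) = L #> (x \<otimes> k \<otimes> inv x)" "x \<otimes> k \<otimes> inv x \<in> K"
    if "x \<in> carrier G" "k \<in> K" for x k
    using conjugate_set_r_coset[OF L that(1)] KG that normal.inv_op_closed2[OF K that] by auto
  have closed: "conjugate_set G x C \<in> carrier (chief_quotient G K L)"
    if "x \<in> carrier G" "C \<in> carrier (chief_quotient G K L)" for x C
    using that conj unfolding carrier_chief_quotient by auto
  show "conjugate_set G g \<in> hom (chief_quotient G K L) (chief_quotient G K L)"
  proof (rule homI)
    fix C D assume "C \<in> carrier (chief_quotient G K L)" "D \<in> carrier (chief_quotient G K L)"
    then obtain a b where a: "a \<in> K" "C = L #> a" and b: "b \<in> K" "D = L #> b"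
      unfolding carrier_chief_quotient by blast
    have G: "a \<in> carrier G" "b \<in> carrier G" using a b KG by auto
    have ab: "a \<otimes> b \<in> K" using subgroup.m_closed[OF normal_imp_subgroup[OF K] a(1) b(1)] .
    have "conjugate_set G g (C <#> D) = L #> (g \<otimes> (a \<otimes> b) \<otimes> inv g)"
      using a b conj(1)[OF g ab] normal.rcos_sum[OF L G] by simp
    also have "g \<otimes> (a \<otimes> b) \<otimes> inv g = g \<otimes> a \<otimes> inv g \<otimes> (g \<otimes> b \<otimes> inv g)"
      using G g by (simp add: m_assoc) (simp add: m_assoc[symmetric])
    also have "L #> \<dots> = conjugate_set G g C <#> conjugate_set G g D"
      using a b conj(1)[OF g] normal.rcos_sum[OF L] G g by simp
    finally show "conjugate_set G g (C \<otimes>\<^bsub>chief_quotient G K L\<^esub> D) =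
        conjugate_set G g C \<otimes>\<^bsub>chief_quotient G K L\<^esub> conjugate_set G g D"
      by (simp add: set_mult_def)
  qed (use closed g in blast)
  show "bij_betw (conjugate_set G g) (carrier (chief_quotient G K L)) (carrier (chief_quotient G K L))"
  proof (rule bij_betw_byWitness[where f' = "conjugate_set G (inv g)"])
    have coset: "L #> k \<subseteq> carrier G" if "k \<in> K" for k
      using r_coset_subset_G[OF subgroup.subset[OF normal_imp_subgroup[OF L]] subsetD[OF KG that]] .
    show "\<forall>C\<in>carrier (chief_quotient G K L). conjugate_set G (inv g) (conjugate_set G g C) = C"
      and "\<forall>C\<in>carrier (chief_quotient G K L). conjugate_set G g (conjugate_set G (inv g) C) = C"
      unfolding carrier_chief_quotient using conjugate_set_inv[OF g coset] by simp_all
    show "conjugate_set G g ` carrier (chief_quotient G K L) \<subseteq> carrier (chief_quotient G K L)"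
      and "conjugate_set G (inv g) ` carrier (chief_quotient G K L) \<subseteq> carrier (chief_quotient G K L)"
      using closed g by auto
  qed
qed

lemma chief_quotient_group_hom:
  assumes "K \<lhd> G" "L \<lhd> G" "L \<subseteq> K"
  shows "group_hom (G\<lparr>carrier := K\<rparr>) (chief_quotient G K L) (\<lambda>x. L #> x)"
proof -
  have K: "subgroup K G" using assms normal_imp_subgroup by blast
  interpret K: group "G\<lparr>carrier := K\<rparr>" using K subgroup_imp_group by blast
  have "(\<lambda>x. L #>\<^bsub>G\<lparr>carrier := K\<rparr>\<^esub> x) = (\<lambda>x. L #> x)" by (simp add: r_coset_def fun_eq_iff)
  then show ?thesis
    using K.group_hom_Mod[OF normal_restrict_supergroup[OF K assms(2,3)]] by simp
qed

lemma subgroup_chief_quotient_preimage: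
  assumes K: "K \<lhd> G" and L: "L \<lhd> G" "L \<subseteq> K" and A: "subgroup A (chief_quotient G K L)"
  defines "M \<equiv> {k \<in> K. L #> k \<in> A}"
  shows "subgroup M G" "L \<subseteq> M" "M \<subseteq> K" "(\<lambda>x. L #> x) ` M = A"
    "M = K \<Longrightarrow> A = carrier (chief_quotient G K L)"
proof -
  interpret hom: group_hom "G\<lparr>carrier := K\<rparr>" "chief_quotient G K L" "\<lambda>x. L #> x"
    using chief_quotient_group_hom[OF K L] .
  note Ksub = normal_imp_subgroup[OF K]
  show "subgroup M G"
    using incl_subgroup[OF Ksub] hom.subgroup_preimage[OF A] by (simp add: M_def)
  have "L #> l = L" if "l \<in> L" for l
    using coset_join2[OF _ normal_imp_subgroup[OF L(1)] that]
      subgroup.mem_carrier[OF normal_imp_subgroup[OF L(1)] that] by blast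
  moreover have "L \<in> A" using subgroup.one_closed[OF A] by simp
  ultimately show "L \<subseteq> M" using L(2) by (auto simp: M_def)
  show "M \<subseteq> K" by (auto simp: M_def)
  have "A \<subseteq> (\<lambda>x. L #> x) ` K" using subgroup.subset[OF A] unfolding carrier_chief_quotient .
  then show im: "(\<lambda>x. L #> x) ` M = A" by (auto simp: M_def)
  show "A = carrier (chief_quotient G K L)" if "M = K"
    using im that unfolding carrier_chief_quotient by simp
qed

text \<open>Conjugation by elements of \<open>G\<close> induces automorphisms of \<open>K / L\<close>, so the preimage of a characteristic
subgroup is normal in \<open>G\<close> and hence is \<open>L\<close> or \<open>K\<close>.\<close>

lemma chief_quotient_characteristically_simple:
  assumes "chief_factor G K L"
  shows "characteristically_simple (chief_quotient G K L)"
  unfolding characteristically_simple_def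
proof (intro allI impI, elim conjE)
  fix A assume A: "subgroup A (chief_quotient G K L)"
    and char: "\<forall>\<alpha> \<in> iso (chief_quotient G K L) (chief_quotient G K L). \<alpha> ` A \<subseteq> A"
  have KL: "K \<lhd> G" "L \<lhd> G" "L \<subseteq> K" and min: "\<And>M. M \<lhd> G \<Longrightarrow> L \<subset> M \<Longrightarrow> M \<subset> K \<Longrightarrow> False"
    using assms by (auto simp: chief_factor_def)
  have KG: "K \<subseteq> carrier G" using subgroup.subset[OF normal_imp_subgroup[OF KL(1)]] .
  define M where "M = {k \<in> K. L #> k \<in> A}"
  note M = subgroup_chief_quotient_preimage[OF KL A, folded M_def]
  have "M \<lhd> G"
  proof (rule normal_invI[OF M(1)])
    fix x k assume x: "x \<in> carrier G" and k: "k \<in> M"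
    have kK: "k \<in> K" "L #> k \<in> A" using k by (auto simp: M_def)
    have "conjugate_set G x (L #> k) \<in> A"
      using imageI[OF kK(2)] bspec[OF char conjugate_set_iso_chief_quotient[OF KL(1,2) x]] by (rule rev_subsetD)
    then show "x \<otimes> k \<otimes> inv x \<in> M"
      using conjugate_set_r_coset[OF KL(2) x, of k] kK(1) KG normal.inv_op_closed2[OF KL(1) x kK(1)]
      by (auto simp: M_def)
  qed
  then consider "M = L" | "M = K" using min M(2,3) by blast
  then show "A = {\<one>\<^bsub>chief_quotient G K L\<^esub>} \<or> A = carrier (chief_quotient G K L)"
  proof cases
    case 1
    have "L #> l = L" if "l \<in> L" for l
      using coset_join2[OF _ normal_imp_subgroup[OF KL(2)] that]
        subgroup.mem_carrier[OF normal_imp_subgroup[OF KL(2)] that] by blast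
    then have "A \<subseteq> {L}" using M(4) 1 by auto
    then show ?thesis using subgroup.one_closed[OF A] by auto
  next
    case 2
    then show ?thesis using M(5) by blast
  qed
qed

text \<open>Let \<open>T\<close> be the preimage of \<open>A\<close> and \<open>U\<close> its residual. Then \<open>U <#> L\<close> is normal in \<open>G\<close> and lies between \<open>L\<close>
and \<open>T\<close>, which is properly contained in \<open>K\<close>. So \<open>U \<subseteq> L\<close>, and the quotient \<open>T / L\<close> of \<open>T / U\<close> is
\<open>p\<close>-supersolvable.\<close>

lemma proper_subgroup_chief_quotient_p_supersolvable:
  assumes fin: "finite (carrier G)" and chief: "chief_factor G K L"
    and res: "\<And>T. subgroup T G \<Longrightarrow> p_supersolvable_residual p (G\<lparr>carrier := T\<rparr>) \<lhd> G"
    and A: "subgroup A (chief_quotient G K L)" "A \<noteq> carrier (chief_quotient G K L)"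
  shows "p_supersolvable p ((chief_quotient G K L)\<lparr>carrier := A\<rparr>)"
proof -
  have KL: "K \<lhd> G" "L \<lhd> G" "L \<subseteq> K" and min: "\<And>M. M \<lhd> G \<Longrightarrow> L \<subset> M \<Longrightarrow> M \<subset> K \<Longrightarrow> False"
    using chief by (auto simp: chief_factor_def)
  interpret KS: group_hom "G\<lparr>carrier := K\<rparr>" "chief_quotient G K L" "\<lambda>x. L #> x"
    using chief_quotient_group_hom[OF KL] .
  define T where "T = {k \<in> K. L #> k \<in> A}"
  note T = subgroup_chief_quotient_preimage[OF KL A(1), folded T_def]
  have TK: "T \<noteq> K" using T(5) A(2) by blast
  interpret T: group "G\<lparr>carrier := T\<rparr>" using T(1) subgroup_imp_group by blast
  have finT: "finite (carrier (G\<lparr>carrier := T\<rparr>))"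
    using finite_subset[OF subgroup.subset[OF T(1)] fin] by simp
  define U where "U = p_supersolvable_residual p (G\<lparr>carrier := T\<rparr>)"
  have U: "U \<lhd> G" "U \<subseteq> T" "p_supersolvable_above p (G\<lparr>carrier := T\<rparr>) U"
    using res[OF T(1)] T.p_supersolvable_residual_normal_above[OF finT]
      subgroup.subset[OF normal_imp_subgroup[OF T.p_supersolvable_residual_normal_above(1)[OF finT]]]
    by (auto simp: U_def)
  have "U <#> L \<subseteq> T" using set_mult_subset_subgroup[OF T(1) U(2) T(2)] .
  then have "U <#> L \<subset> K" using TK T(3) by blast
  moreover have "U <#> L \<lhd> G" using normal_subgroup_set_mult_closed[OF U(1) KL(2)] .
  ultimately have "\<not> L \<subset> U <#> L" using min by blast
  then have "U \<subseteq> L"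
    using subset_set_mult[OF normal_imp_subgroup[OF U(1)] normal_imp_subgroup[OF KL(2)]] by blast
  have "subgroup T (G\<lparr>carrier := K\<rparr>)"
    using subgroup_incl[OF T(1) normal_imp_subgroup[OF KL(1)] T(3)] .
  then interpret TA: group_hom "G\<lparr>carrier := T\<rparr>" "(chief_quotient G K L)\<lparr>carrier := A\<rparr>" "\<lambda>x. L #> x"
    using KS.induced_group_hom T(4) by fastforce
  show ?thesis
  proof (rule TA.p_supersolvable_image[OF finT _ U(3)])
    show "(\<lambda>x. L #> x) ` carrier (G\<lparr>carrier := T\<rparr>) = carrier ((chief_quotient G K L)\<lparr>carrier := A\<rparr>)"
      using T(4) by simp
    have "L #> x = L" if "x \<in> U" for x
      using coset_join2[OF _ normal_imp_subgroup[OF KL(2)], of x] that \<open>U \<subseteq> L\<close>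
        subgroup.mem_carrier[OF normal_imp_subgroup[OF KL(2)], of x] by blast
    then show "U \<subseteq> kernel (G\<lparr>carrier := T\<rparr>) ((chief_quotient G K L)\<lparr>carrier := A\<rparr>) (\<lambda>x. L #> x)"
      using U(2) by (auto simp: kernel_def)
  qed
qed

theorem p_solvable_if_residuals_normal:
  assumes fin: "finite (carrier G)" and p: "prime p"
    and least: "\<And>q. prime q \<Longrightarrow> q dvd order G \<Longrightarrow> p \<le> q"
    and res: "\<And>T. subgroup T G \<Longrightarrow> p_supersolvable_residual p (G\<lparr>carrier := T\<rparr>) \<lhd> G"
  shows "p_solvable p G"
  unfolding p_solvable_def
proof (intro conjI allI impI)
  fix K L assume chief: "chief_factor G K L"
  then have KL: "K \<lhd> G" "L \<lhd> G" "L \<subseteq> K" by (auto simp: chief_factor_def)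
  interpret KS: group_hom "G\<lparr>carrier := K\<rparr>" "chief_quotient G K L" "\<lambda>x. L #> x"
    using chief_quotient_group_hom[OF KL] .
  have "finite K" using finite_subset[OF subgroup.subset[OF normal_imp_subgroup[OF KL(1)]] fin] .
  then have finS: "finite (carrier (chief_quotient G K L))" by (simp add: carrier_chief_quotient)
  have dvd: "order (chief_quotient G K L) dvd order G"
    using order_chief_quotient[OF KL] lagrange[OF normal_imp_subgroup[OF KL(1)]]
    by (metis dvd_mult2 dvd_triv_left dvd_trans dvd_triv_right)
  have "is_p_group p (chief_quotient G K L)" if "p dvd order (chief_quotient G K L)"
  proof (rule KS.H.p_group_if_proper_subgroups_p_supersolvable[OF finS p that])
    show "p \<le> q" if "prime q" "q dvd order (chief_quotient G K L)" for q
      using least[OF that(1) dvd_trans[OF that(2) dvd]] .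
    show "characteristically_simple (chief_quotient G K L)"
      using chief_quotient_characteristically_simple[OF chief] .
    show "p_supersolvable p ((chief_quotient G K L)\<lparr>carrier := A\<rparr>)"
      if "subgroup A (chief_quotient G K L)" "A \<noteq> carrier (chief_quotient G K L)" for A
      using proper_subgroup_chief_quotient_p_supersolvable[OF fin chief res that] .
  qed
  then show "is_p_group p (chief_quotient G K L) \<or> is_p'_group p (chief_quotient G K L)"
    by (auto simp: is_p'_group_def)
qed (use is_group fin in auto)

end

theorem theorem4p5:
  fixes G :: "('a, 'b) monoid_scheme" and H :: "'a set" and p :: nat
  assumes "group G" and "finite (carrier G)"
    and "subgroup H G"
    and "p \<in> order_primes (G\<lparr>carrier := H\<rparr>)"
    and "\<forall>q \<in> order_primes (G\<lparr>carrier := H\<rparr>). p \<le> q"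
    and "carrier G = residual_normalizer p G H"
  shows "p_solvable p (G\<lparr>carrier := H\<rparr>)"
proof -
  interpret group G by fact
  interpret H: group "G\<lparr>carrier := H\<rparr>" using assms(3) subgroup_imp_group by blast
  have finH: "finite (carrier (G\<lparr>carrier := H\<rparr>))"
    using finite_subset[OF subgroup.subset[OF assms(3)] assms(2)] by simp
  show ?thesis
  proof (rule H.p_solvable_if_residuals_normal[OF finH])
    show "prime p" using assms(4) by (simp add: order_primes_def in_prime_factors_iff)
    have "order (G\<lparr>carrier := H\<rparr>) \<noteq> 0" using finH H.order_gt_0_iff_finite by simp
    then show "p \<le> q" if "prime q" "q dvd order (G\<lparr>carrier := H\<rparr>)" for q
      using assms(5) that by (auto simp: order_primes_def in_prime_factors_iff)
    fix T assume T: "subgroup T (G\<lparr>carrier := H\<rparr>)"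
    have TG: "subgroup T G" using incl_subgroup[OF assms(3) T] .
    have TH: "T \<subseteq> H" using subgroup.subset[OF T] by simp
    interpret T: group "G\<lparr>carrier := T\<rparr>" using TG subgroup_imp_group by blast
    have finT: "finite (carrier (G\<lparr>carrier := T\<rparr>))"
      using finite_subset[OF subgroup.subset[OF TG] assms(2)] by simp
    define U where "U = p_supersolvable_residual p (G\<lparr>carrier := T\<rparr>)"
    have "subgroup U (G\<lparr>carrier := T\<rparr>)"
      using normal_imp_subgroup[OF T.p_supersolvable_residual_normal_above(1)[OF finT]] by (simp add: U_def)
    then have U: "subgroup U G" "U \<subseteq> T"
      using incl_subgroup[OF TG] subgroup.subset[of U "G\<lparr>carrier := T\<rparr>"] by simp_all
    have "residual_normalizer p G H \<subseteq> normalizer G U"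
      using T by (auto simp: residual_normalizer_def U_def)
    then have "normalizer G U = carrier G"
      using assms(6) subgroup.subset[OF normalizer_imp_subgroup[OF subgroup.subset[OF U(1)]]] by blast
    then have "U \<lhd> G" using normal_iff_normalizer[OF U(1)] by blast
    then have "U \<lhd> G\<lparr>carrier := H\<rparr>" using normal_restrict_supergroup[OF assms(3)] U(2) TH by blast
    then show "p_supersolvable_residual p (G\<lparr>carrier := H, carrier := T\<rparr>) \<lhd> G\<lparr>carrier := H\<rparr>"
      by (simp add: U_def)
  qed
qed

end
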